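(* Let $F$ be a field of characteristic zero, $n\in\mathbb N$, and let $q=(q_1,\ldots,q_k)$ be a composition of $n$. Suppose that $l=(l_1,\ldots,l_k)$ is a generic $k$-tuple of homogeneous Lie monomials, of type $q$. Then $U_l\cong\Lambda_Q$ as a $\mathcal B_n$-module, for any $Q\in\Pi_n$ of type $q$.
   Context: A composition of $n$ is a finite sequence of positive integers with sum $n$. A set composition of a finite set $A\subset\mathbb N$ is a tuple $P=(P_1,\ldots,P_m)$ of mutually disjoint non-empty subsets of $A$ with union $A$; its length is $\ell(P)=m$ and its type is $(\#P_1,\ldots,\#P_m)$; $\Pi_A$ is the set of set compositions of $A$, $\Pi_n=\Pi_{\{1,\ldots,n\}}$. $F\Pi_A$ is the $F$-vector space with basis $\Pi_A$, an algebra under the bilinear product $(P_1,\ldots,P_m)\wedge(R_1,\ldots,R_s)=(P_1\cap R_1,\ldots,P_1\cap R_s,\ldots,P_m\cap R_1,\ldots,P_m\cap R_s)$ with empty sets deleted. On $\bigoplus_AF\Pi_A$, $\vee$ is the bilinear product which concatenates set compositions of disjoint sets (and is $0$ on set compositions of non-disjoint sets). For non-empty finite $A$: $e_A=\sum_P(-1)^{\ell(P)-1}P$, over all $P=(P_1,\ldots,P_m)\in\Pi_A$ with $\min A\in P_1$; for $Q=(Q_1,\ldots,Q_k)\in\Pi_n$: $e_Q=e_{Q_1}\vee\cdots\vee e_{Q_k}$ and $\Lambda_Q=F\Pi_n\wedge e_Q$, a left ideal of $F\Pi_n$. The symmetric group $S_n$ acts on $\Pi_n$ by $(P_1,\ldots,P_m)^\pi=(P_1\pi,\ldots,P_m\pi)$;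 permutations act on the right and are multiplied accordingly, $i(\pi\sigma)=(i\pi)\sigma$. $\mathcal B_n$ is the subalgebra of $S_n$-invariants of $F\Pi_n$, with basis $X^r=\sum_{\mathrm{type}(P)=r}P$, $r$ a composition of $n$. $\Lambda_Q$ is a $\mathcal B_n$-module by restriction. For a composition $r=(r_1,\ldots,r_m)$ of $n$, $S_r\cong S_{r_1}\times\cdots\times S_{r_m}$ is the usual Young subgroup of $S_n$, and $\Xi^r\in FS_n$ is the sum of the unique representatives of minimal length (number of inversions) of the right cosets $S_r\pi$. The span $\mathcal D_n$ of the $\Xi^r$ is a subalgebra of $FS_n$ (the Solomon algebra), and $X^r\mapsto\Xi^r$ defines an algebra isomorphism $\mathcal B_n\to\mathcal D_n$ (Bidigare). Let $\mathcal A(X)=\bigoplus_{n\ge0}\mathcal A_n(X)$ be the free associative $F$-algebra over an infinite set $X$, graded by degree; $FS_n$ acts on the left on $\mathcal A_n(X)$ by (Polya action) $\pi\,x_1\cdots x_n=x_{1\pi}\cdots x_{n\pi}$ ($x_i\in X$). $\mathcal L(X)=\bigoplus_{n\ge1}\mathcal L_n(X)$ is the Lie subalgebra of $\mathcal A(X)$ (with bracket $ab-ba$) generated by $X$. A Lie monomial is an iterated Lie bracket of elements of $X$. A $k$-tuple $l=(l_1,\ldots,l_k)$ of homogeneous Lie monomials with $l_1\cdots l_k\in\mathcal A_n(X)$ is generic if the elements $l_{1\pi}\cdots l_{k\pi}$ ($\pi\in S_k$) are linearly independent; its type is the composition $(q_1,\ldots,q_k)$ of $n$ with $l_i\in\mathcal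 L_{q_i}(X)$ for all $i$. $U_l$ is the $F$-linear span of the elements $l_{1\pi}\cdots l_{k\pi}$ ($\pi\in S_k$); by a theorem of Garsia and Reutenauer it is stable under the Polya action of $\mathcal D_n$, so it is a $\mathcal D_n$-module, viewed as a $\mathcal B_n$-module via the algebra isomorphism $\mathcal B_n\to\mathcal D_n$, $X^r\mapsto\Xi^r$ ($r$ a composition of $n$). *)

theory Defs
  imports Complex_Main "HOL-Library.Poly_Mapping" "HOL-Combinatorics.Permutations"
begin

section \<open>Vector spaces with a given basis\<close>

text \<open>The vector space over \<open>'f\<close> with basis \<open>'a\<close> is \<^typ>\<open>'a \<Rightarrow>\<^sub>0 'f\<close>; the basis element
  belonging to \<open>a\<close> is \<open>Poly_Mapping.single a 1\<close>.\<close>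

definition pscale :: "'f::field \<Rightarrow> ('a \<Rightarrow>\<^sub>0 'f) \<Rightarrow> ('a \<Rightarrow>\<^sub>0 'f)" where
  "pscale c = Poly_Mapping.map ((*) c)"

lemma lookup_pscale [simp]:
  "Poly_Mapping.lookup (pscale c f) a = c * Poly_Mapping.lookup f a"
  by (simp add: pscale_def Poly_Mapping.map.rep_eq when_def)

global_interpretation pm: vector_space "pscale :: 'f::field \<Rightarrow> ('a \<Rightarrow>\<^sub>0 'f) \<Rightarrow> ('a \<Rightarrow>\<^sub>0 'f)"
  by unfold_locales (auto intro!: poly_mapping_eqI simp: lookup_add algebra_simps)

definition linear_ext :: "('a \<Rightarrow> 'b \<Rightarrow>\<^sub>0 'f) \<Rightarrow> ('a \<Rightarrow>\<^sub>0 'f::field) \<Rightarrow> ('b \<Rightarrow>\<^sub>0 'f)" where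
  "linear_ext m f = (\<Sum>a\<in>Poly_Mapping.keys f. pscale (Poly_Mapping.lookup f a) (m a))"

definition bilinear_ext ::
    "('a \<Rightarrow> 'b \<Rightarrow> 'c \<Rightarrow>\<^sub>0 'f) \<Rightarrow> ('a \<Rightarrow>\<^sub>0 'f::field) \<Rightarrow> ('b \<Rightarrow>\<^sub>0 'f) \<Rightarrow> ('c \<Rightarrow>\<^sub>0 'f)" where
  "bilinear_ext m f g = linear_ext (\<lambda>a. linear_ext (m a) g) f"


section \<open>Set compositions and the algebra they span\<close>

definition compositions :: "nat \<Rightarrow> nat list set" where
  "compositions n = {r. (\<forall>i\<in>set r. 0 < i) \<and> sum_list r = n}"

definition set_compositions :: "nat set \<Rightarrow> nat set list set" where
  "set_compositions A = {P. (\<forall>B\<in>set P. B \<noteq> {}) \<and> \<Union>(set P) = A \<and>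
     (\<forall>i<length P. \<forall>j<length P. i \<noteq> j \<longrightarrow> P ! i \<inter> P ! j = {})}"

lemma finite_set_compositions:
  assumes "finite A"
  shows "finite (set_compositions A)"
proof (rule finite_subset)
  show "set_compositions A \<subseteq> {P. set P \<subseteq> Pow A \<and> distinct P}"
    by (auto simp: set_compositions_def distinct_conv_nth) (metis Int_absorb nth_mem)
  show "finite {P. set P \<subseteq> Pow A \<and> distinct P}"
    using assms by (simp add: finite_subset_distinct)
qed

definition comp_type :: "nat set list \<Rightarrow> nat list" where
  "comp_type P = map card P"

definition F\<Pi> :: "nat set \<Rightarrow> (nat set list \<Rightarrow>\<^sub>0 'f::field) set" where
  "F\<Pi> A = {f. Poly_Mapping.keys f \<subseteq> set_compositions A}"

definition wedge_basis :: "nat set list \<Rightarrow> nat set list \<Rightarrow> nat set list" where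
  "wedge_basis P R = filter (\<lambda>B. B \<noteq> {}) (concat (map (\<lambda>B. map (\<lambda>C. B \<inter> C) R) P))"

definition wedge ::
    "(nat set list \<Rightarrow>\<^sub>0 'f::field) \<Rightarrow> (nat set list \<Rightarrow>\<^sub>0 'f) \<Rightarrow> (nat set list \<Rightarrow>\<^sub>0 'f)" where
  "wedge = bilinear_ext (\<lambda>P R. Poly_Mapping.single (wedge_basis P R) 1)"

definition vee ::
    "(nat set list \<Rightarrow>\<^sub>0 'f::field) \<Rightarrow> (nat set list \<Rightarrow>\<^sub>0 'f) \<Rightarrow> (nat set list \<Rightarrow>\<^sub>0 'f)" where
  "vee = bilinear_ext (\<lambda>P R. if \<Union>(set P) \<inter> \<Union>(set R) = {}
                              then Poly_Mapping.single (P @ R) 1 else 0)"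

definition e_set :: "nat set \<Rightarrow> (nat set list \<Rightarrow>\<^sub>0 'f::field)" where
  "e_set A = (\<Sum>P\<in>{P \<in> set_compositions A. Min A \<in> P ! 0}.
                Poly_Mapping.single P ((-1) ^ (length P - 1)))"

text \<open>The empty set composition is the unit of \<^const>\<open>vee\<close>.\<close>

definition e_comp :: "nat set list \<Rightarrow> (nat set list \<Rightarrow>\<^sub>0 'f::field)" where
  "e_comp Q = foldr vee (map e_set Q) (Poly_Mapping.single [] 1)"

definition \<Lambda> :: "nat \<Rightarrow> nat set list \<Rightarrow> (nat set list \<Rightarrow>\<^sub>0 'f::field) set" where
  "\<Lambda> n Q = (\<lambda>f. wedge f (e_comp Q)) ` F\<Pi> {1..n}"


section \<open>The algebra of invariants\<close>

text \<open>Permutations of \<open>{1..n}\<close> are functions on \<^typ>\<open>nat\<close>; they act on the right, so that the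
  image of \<open>i\<close> under \<open>\<pi>\<close> is \<open>\<pi> i\<close>, while the product \<open>\<pi>\<sigma>\<close> (first \<open>\<pi>\<close>, then \<open>\<sigma>\<close>) is the
  function \<open>\<sigma> \<circ> \<pi>\<close>.\<close>

definition perm_act :: "(nat \<Rightarrow> nat) \<Rightarrow> (nat set list \<Rightarrow>\<^sub>0 'f::field) \<Rightarrow> (nat set list \<Rightarrow>\<^sub>0 'f)" where
  "perm_act \<pi> = linear_ext (\<lambda>P. Poly_Mapping.single (map (\<lambda>B. \<pi> ` B) P) 1)"

definition \<B> :: "nat \<Rightarrow> (nat set list \<Rightarrow>\<^sub>0 'f::field) set" where
  "\<B> n = {f \<in> F\<Pi> {1..n}. \<forall>\<pi>. \<pi> permutes {1..n} \<longrightarrow> perm_act \<pi> f = f}"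

text \<open>The identity of \<open>F\<Pi> {1..n}\<close>, which lies in \<open>\<B> n\<close>; blocks being non-empty, it is the empty
  set composition if \<open>n = 0\<close>.\<close>

definition \<B>_one :: "nat \<Rightarrow> (nat set list \<Rightarrow>\<^sub>0 'f::field)" where
  "\<B>_one n = Poly_Mapping.single (if n = 0 then [] else [{1..n}]) 1"

definition X_elt :: "nat list \<Rightarrow> (nat set list \<Rightarrow>\<^sub>0 'f::field)" where
  "X_elt r = (\<Sum>P\<in>{P \<in> set_compositions {1..sum_list r}. comp_type P = r}.
                Poly_Mapping.single P 1)"


section \<open>The Solomon algebra\<close>

definition inversions :: "nat \<Rightarrow> (nat \<Rightarrow> nat) \<Rightarrow> nat" where
  "inversions n \<pi> = card {(i, j). 1 \<le> i \<and> i < j \<and> j \<le> n \<and> \<pi> j < \<pi> i}"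

definition young_block :: "nat list \<Rightarrow> nat \<Rightarrow> nat set" where
  "young_block r i = {sum_list (take i r) <.. sum_list (take (Suc i) r)}"

definition young_subgroup :: "nat list \<Rightarrow> (nat \<Rightarrow> nat) set" where
  "young_subgroup r = {\<sigma>. \<sigma> permutes {1..sum_list r} \<and>
     (\<forall>i<length r. \<sigma> ` young_block r i = young_block r i)}"

text \<open>The coset \<open>S\<^sub>r \<pi>\<close> consists of the products \<open>\<sigma>\<pi>\<close> (first \<open>\<sigma>\<close>, then \<open>\<pi>\<close>) with \<open>\<sigma>\<close> in \<open>S\<^sub>r\<close>.\<close>

definition right_coset :: "nat list \<Rightarrow> (nat \<Rightarrow> nat) \<Rightarrow> (nat \<Rightarrow> nat) set" where
  "right_coset r \<pi> = (\<lambda>\<sigma>. \<pi> \<circ> \<sigma>) ` young_subgroup r"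

definition min_coset_reps :: "nat list \<Rightarrow> (nat \<Rightarrow> nat) set" where
  "min_coset_reps r = {\<pi>. \<pi> permutes {1..sum_list r} \<and>
     (\<forall>\<tau>\<in>right_coset r \<pi>. inversions (sum_list r) \<pi> \<le> inversions (sum_list r) \<tau>)}"

definition \<Xi> :: "nat list \<Rightarrow> ((nat \<Rightarrow> nat) \<Rightarrow>\<^sub>0 'f::field)" where
  "\<Xi> r = (\<Sum>\<pi>\<in>min_coset_reps r. Poly_Mapping.single \<pi> 1)"

text \<open>The linear map on \<open>\<B> n\<close> with \<open>X\<^sup>r \<mapsto> \<Xi>\<^sup>r\<close>, given by the coordinates with respect to the
  basis of all \<open>X\<^sup>s\<close>.\<close>

definition bidigare :: "nat \<Rightarrow> (nat set list \<Rightarrow>\<^sub>0 'f::field) \<Rightarrow> ((nat \<Rightarrow> nat) \<Rightarrow>\<^sub>0 'f)" where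
  "bidigare n b = (\<Sum>r\<in>compositions n.
     pscale (pm.representation (X_elt ` compositions n) b (X_elt r)) (\<Xi> r))"


lemma ex_set_composition_of_type:
  assumes "\<forall>i\<in>set r. 0 < i"
  shows "\<exists>P\<in>set_compositions {1..sum_list r}. comp_type P = r"
  using assms
proof (induction r rule: rev_induct)
  case Nil
  show ?case by (rule bexI[of _ "[]"]) (auto simp: set_compositions_def comp_type_def)
next
  case (snoc x r)
  then obtain P where P: "P \<in> set_compositions {1..sum_list r}" "comp_type P = r" by auto
  let ?B = "{Suc (sum_list r)..sum_list r + x}"
  have U: "\<Union>(set P) = {1..sum_list r}" using P(1) by (simp add: set_compositions_def)
  have disj: "P ! i \<inter> ?B = {}" if "i < length P" for i
  proof -
    have "P ! i \<subseteq> {1..sum_list r}" using nth_mem[OF that] U by blast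
    then show ?thesis by fastforce
  qed
  have 1: "(P @ [?B]) ! i \<inter> (P @ [?B]) ! j = {}"
    if ij: "i < length (P @ [?B])" "j < length (P @ [?B])" "i \<noteq> j" for i j
  proof (cases "i < length P"; cases "j < length P")
    assume "i < length P" "j < length P"
    then show ?thesis using P(1) ij(3) by (simp add: set_compositions_def nth_append)
  next
    assume i: "i < length P" and "\<not> j < length P"
    then have "(P @ [?B]) ! j = ?B" using ij(2) by (simp add: nth_append)
    then show ?thesis using disj[OF i] i by (simp only: nth_append if_True)
  next
    assume "\<not> i < length P" and j: "j < length P"
    then have "(P @ [?B]) ! i = ?B" using ij(1) by (simp add: nth_append)
    then show ?thesis using disj[OF j] j by (simp only: nth_append if_True Int_commute)
  next
    assume "\<not> i < length P" "\<not> j < length P"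
    then show ?thesis using ij by simp
  qed
  have 2: "\<Union>(set (P @ [?B])) = {1..sum_list (r @ [x])}"
  proof -
    have "\<Union>(set (P @ [?B])) = {1..sum_list r} \<union> ?B" using U by (simp add: Un_commute)
    also have "\<dots> = {1..sum_list (r @ [x])}" by auto
    finally show ?thesis .
  qed
  have 3: "B \<noteq> {}" if "B \<in> set (P @ [?B])" for B
    using that P(1) snoc.prems by (auto simp: set_compositions_def)
  have "P @ [?B] \<in> set_compositions {1..sum_list (r @ [x])}"
    using 1 2 3 unfolding set_compositions_def mem_Collect_eq by (intro conjI ballI allI impI)
  moreover have "comp_type (P @ [?B]) = r @ [x]" using P(2) by (simp add: comp_type_def)
  ultimately show ?case by blast
qed

lemma lookup_X_elt:
  "Poly_Mapping.lookup (X_elt r :: _ \<Rightarrow>\<^sub>0 'f::field) P =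
     (if P \<in> set_compositions {1..sum_list r} \<and> comp_type P = r then 1 else 0)"
proof -
  have "finite {P \<in> set_compositions {1..sum_list r}. comp_type P = r}"
    by (simp add: finite_set_compositions)
  then show ?thesis
    by (simp add: X_elt_def lookup_sum lookup_single when_def sum.delta' del: sum.inter_filter)
qed

lemma finite_compositions: "finite (compositions n)"
proof -
  have "length r \<le> sum_list r" if "\<forall>i\<in>set r. 0 < i" for r :: "nat list"
    using that by (induction r) auto
  then have "compositions n \<subseteq> {r. set r \<subseteq> {..n} \<and> length r \<le> n}"
    by (auto simp: compositions_def member_le_sum_list)
  then show ?thesis by (rule finite_subset) (simp add: finite_lists_length_le)
qed

lemma
  shows inj_on_X_elt: "inj_on (X_elt :: _ \<Rightarrow> _ \<Rightarrow>\<^sub>0 'f::field) (compositions n)"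
    and independent_X_elt:
      "pm.independent (X_elt ` compositions n :: (nat set list \<Rightarrow>\<^sub>0 'f::field) set)"
proof -
  let ?X = "X_elt :: _ \<Rightarrow> _ \<Rightarrow>\<^sub>0 'f"
  obtain P where P: "\<And>r. r \<in> compositions n \<Longrightarrow>
      P r \<in> set_compositions {1..sum_list r} \<and> comp_type (P r) = r"
    using ex_set_composition_of_type unfolding compositions_def by (metis (mono_tags, lifting) mem_Collect_eq)
  have L: "Poly_Mapping.lookup (?X s) (P r) = (if r = s then 1 else 0)"
    if "r \<in> compositions n" for r s
    using P[OF that] by (auto simp: lookup_X_elt)
  show inj: "inj_on ?X (compositions n)"
    by (rule inj_onI) (metis L zero_neq_one)
  show "pm.independent (?X ` compositions n)"
  proof (rule pm.independent_if_scalars_zero)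
    show "finite (?X ` compositions n)" by (simp add: finite_compositions)
    fix f x assume "(\<Sum>x\<in>?X ` compositions n. pscale (f x) x) = 0" and x: "x \<in> ?X ` compositions n"
    then have 0: "(\<Sum>s\<in>compositions n. pscale (f (?X s)) (?X s)) = 0"
      by (simp add: sum.reindex[OF inj])
    obtain r where r: "r \<in> compositions n" "x = ?X r" using x by blast
    have "0 = Poly_Mapping.lookup (\<Sum>s\<in>compositions n. pscale (f (?X s)) (?X s)) (P r)"
      by (simp add: 0)
    also have "\<dots> = (\<Sum>s\<in>compositions n. if s = r then f (?X s) else 0)"
      unfolding lookup_sum by (rule sum.cong) (simp_all add: L[OF r(1)])
    also have "\<dots> = f x" using r by (simp add: finite_compositions)
    finally show "f x = 0" by simp
  qed
qed

lemma bidigare_X_elt: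
  assumes "r \<in> compositions n"
  shows "bidigare n (X_elt r) = (\<Xi> r :: _ \<Rightarrow>\<^sub>0 'f::field)"
proof -
  have "pm.representation (X_elt ` compositions n) (X_elt r :: _ \<Rightarrow>\<^sub>0 'f) (X_elt s) =
      (if s = r then 1 else 0)" if "s \<in> compositions n" for s
  proof -
    have "(X_elt s :: _ \<Rightarrow>\<^sub>0 'f) = X_elt r \<longleftrightarrow> s = r"
      using inj_on_eq_iff[OF inj_on_X_elt that assms] .
    moreover have "(X_elt r :: _ \<Rightarrow>\<^sub>0 'f) \<in> X_elt ` compositions n"
      using assms by (rule imageI)
    ultimately show ?thesis
      by (simp only: pm.representation_basis[OF independent_X_elt])
  qed
  then have "bidigare n (X_elt r) = (\<Sum>s\<in>compositions n. if s = r then \<Xi> s else (0 :: _ \<Rightarrow>\<^sub>0 'f))"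
    unfolding bidigare_def by (intro sum.cong) auto
  then show ?thesis using assms by (simp add: finite_compositions)
qed


section \<open>The free associative algebra and its Lie elements\<close>

text \<open>The wrapper around lists makes the words an additive monoid, so that the multiplication on
  \<open>'x free_monoid \<Rightarrow>\<^sub>0 'f\<close> from the library is the one of the free associative algebra.\<close>

datatype 'x free_monoid = Word (letters: "'x list")

instantiation free_monoid :: (type) monoid_add
begin

definition zero_free_monoid :: "'a free_monoid" where
  "0 = Word []"

definition plus_free_monoid :: "'a free_monoid \<Rightarrow> 'a free_monoid \<Rightarrow> 'a free_monoid" where
  "u + v = Word (letters u @ letters v)"

instance
  by standard (simp_all add: zero_free_monoid_def plus_free_monoid_def)

end

type_synonym ('x, 'f) free_algebra = "'x free_monoid \<Rightarrow>\<^sub>0 'f"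

definition gen :: "'x \<Rightarrow> ('x, 'f::field) free_algebra" where
  "gen x = Poly_Mapping.single (Word [x]) 1"

definition homogeneous :: "nat \<Rightarrow> ('x, 'f::field) free_algebra set" where
  "homogeneous n = {f. \<forall>w\<in>Poly_Mapping.keys f. length (letters w) = n}"

definition polya_word :: "(nat \<Rightarrow> nat) \<Rightarrow> 'x free_monoid \<Rightarrow> 'x free_monoid" where
  "polya_word \<pi> w = Word (map (\<lambda>i. letters w ! (\<pi> i - 1)) [1..<Suc (length (letters w))])"

definition polya ::
    "((nat \<Rightarrow> nat) \<Rightarrow>\<^sub>0 'f::field) \<Rightarrow> ('x, 'f) free_algebra \<Rightarrow> ('x, 'f) free_algebra" where
  "polya = bilinear_ext (\<lambda>\<pi> w. Poly_Mapping.single (polya_word \<pi> w) 1)"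

definition lie_bracket ::
    "('x, 'f::field) free_algebra \<Rightarrow> ('x, 'f) free_algebra \<Rightarrow> ('x, 'f) free_algebra" where
  "lie_bracket a b = a * b - b * a"

definition lie_algebra :: "('x, 'f::field) free_algebra set" where
  "lie_algebra = (\<lambda>L. pm.subspace L \<and> (\<forall>a\<in>L. \<forall>b\<in>L. lie_bracket a b \<in> L)) hull range gen"

definition lie_homogeneous :: "nat \<Rightarrow> ('x, 'f::field) free_algebra set" where
  "lie_homogeneous n = lie_algebra \<inter> homogeneous n"

inductive_set lie_monomials :: "('x, 'f::field) free_algebra set" where
  "gen x \<in> lie_monomials"
| "a \<in> lie_monomials \<Longrightarrow> b \<in> lie_monomials \<Longrightarrow> lie_bracket a b \<in> lie_monomials"

definition has_lie_type :: "('x, 'f::field) free_algebra list \<Rightarrow> nat list \<Rightarrow> bool" where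
  "has_lie_type l q \<longleftrightarrow> list_all2 (\<lambda>a d. a \<in> lie_homogeneous d) l q"

definition perm_prod ::
    "('x, 'f::field) free_algebra list \<Rightarrow> (nat \<Rightarrow> nat) \<Rightarrow> ('x, 'f) free_algebra" where
  "perm_prod l \<pi> = prod_list (map (\<lambda>i. l ! (\<pi> i - 1)) [1..<Suc (length l)])"

text \<open>Linear independence is that of a family indexed by the permutations, hence the injectivity.\<close>

definition generic :: "('x, 'f::field) free_algebra list \<Rightarrow> bool" where
  "generic l \<longleftrightarrow> inj_on (perm_prod l) {\<pi>. \<pi> permutes {1..length l}} \<and>
     pm.independent (perm_prod l ` {\<pi>. \<pi> permutes {1..length l}})"

definition U_span :: "('x, 'f::field) free_algebra list \<Rightarrow> ('x, 'f) free_algebra set" where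
  "U_span l = pm.span (perm_prod l ` {\<pi>. \<pi> permutes {1..length l}})"

definition U_act ::
    "nat \<Rightarrow> (nat set list \<Rightarrow>\<^sub>0 'f::field) \<Rightarrow> ('x, 'f) free_algebra \<Rightarrow> ('x, 'f) free_algebra" where
  "U_act n b u = polya (bidigare n b) u"


section \<open>Modules over the algebra of invariants\<close>

locale \<B>_module =
  fixes n :: nat
    and act :: "(nat set list \<Rightarrow>\<^sub>0 'f::field) \<Rightarrow> ('a \<Rightarrow>\<^sub>0 'f) \<Rightarrow> ('a \<Rightarrow>\<^sub>0 'f)"
    and M :: "('a \<Rightarrow>\<^sub>0 'f) set"
  assumes subspace: "pm.subspace M"
    and act_closed: "b \<in> \<B> n \<Longrightarrow> u \<in> M \<Longrightarrow> act b u \<in> M"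
    and act_add_left: "b \<in> \<B> n \<Longrightarrow> c \<in> \<B> n \<Longrightarrow> u \<in> M \<Longrightarrow> act (b + c) u = act b u + act c u"
    and act_add_right: "b \<in> \<B> n \<Longrightarrow> u \<in> M \<Longrightarrow> v \<in> M \<Longrightarrow> act b (u + v) = act b u + act b v"
    and act_scale_left: "b \<in> \<B> n \<Longrightarrow> u \<in> M \<Longrightarrow> act (pscale x b) u = pscale x (act b u)"
    and act_scale_right: "b \<in> \<B> n \<Longrightarrow> u \<in> M \<Longrightarrow> act b (pscale x u) = pscale x (act b u)"
    and act_mult: "b \<in> \<B> n \<Longrightarrow> c \<in> \<B> n \<Longrightarrow> u \<in> M \<Longrightarrow> act (wedge b c) u = act b (act c u)"
    and act_one: "u \<in> M \<Longrightarrow> act (\<B>_one n) u = u"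

definition \<B>_module_isomorphic ::
    "nat \<Rightarrow> ((nat set list \<Rightarrow>\<^sub>0 'f::field) \<Rightarrow> ('a \<Rightarrow>\<^sub>0 'f) \<Rightarrow> ('a \<Rightarrow>\<^sub>0 'f)) \<Rightarrow> ('a \<Rightarrow>\<^sub>0 'f) set \<Rightarrow>
     ((nat set list \<Rightarrow>\<^sub>0 'f) \<Rightarrow> ('b \<Rightarrow>\<^sub>0 'f) \<Rightarrow> ('b \<Rightarrow>\<^sub>0 'f)) \<Rightarrow> ('b \<Rightarrow>\<^sub>0 'f) set \<Rightarrow> bool" where
  "\<B>_module_isomorphic n act M act' N \<longleftrightarrow>
     \<B>_module n act M \<and> \<B>_module n act' N \<and>
     (\<exists>\<phi>. bij_betw \<phi> M N \<and>
          (\<forall>u\<in>M. \<forall>v\<in>M. \<phi> (u + v) = \<phi> u + \<phi> v) \<and>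
          (\<forall>x. \<forall>u\<in>M. \<phi> (pscale x u) = pscale x (\<phi> u)) \<and>
          (\<forall>b\<in>\<B> n. \<forall>u\<in>M. \<phi> (act b u) = act' b (\<phi> u)))"

end

theory Submission
  imports Defs "HOL-Library.Product_Plus" "HOL-Library.FuncSet"
begin

text \<open>
  Both modules have a basis indexed by the orderings \<open>\<sigma>\<close> of the labels \<open>1, \<dots>, k\<close>: the products
  \<open>l\<^sub>\<sigma> = l\<^bsub>\<sigma>1\<^esub> \<cdots> l\<^bsub>\<sigma>k\<^esub>\<close> in \<open>U\<^sub>l\<close> (this is genericity), and the elements
  \<open>e\<^sub>\<sigma> = e\<^sub>R\<close> with \<open>R = (Q\<^bsub>\<sigma>1\<^esub>, \<dots>, Q\<^bsub>\<sigma>k\<^esub>)\<close> in \<open>\<Lambda>\<^sub>Q\<close>. The linear map \<open>l\<^sub>\<sigma> \<mapsto> e\<^sub>\<sigma>\<close> is an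
  isomorphism because the invariant \<open>X\<^sup>r\<close> acts on both bases by the same formula:
  \<open>X\<^sup>r v\<^sub>\<sigma> = \<Sum>\<^sub>T v\<^bsub>T\<sigma>\<^esub>\<close>, where \<open>T\<close> runs over the set compositions of \<open>{1..k}\<close> for which the sums of
  the \<open>q\<^sub>i\<close> over the blocks form the composition \<open>r\<close>, and the word \<open>T\<sigma>\<close> (\<open>reorder T \<sigma>\<close> below) lists
  the labels block by block, each block in the order prescribed by \<open>\<sigma>\<close>.

  On the side of \<open>\<Lambda>\<^sub>Q\<close> the formula (\<open>X_elt_wedge_e_comp\<close>) results from the action of the
  single set compositions \<open>P\<close>. If \<open>P\<close> splits one of the blocks \<open>Q\<^sub>i\<close>, then \<open>P \<and> e\<^sub>Q = 0\<close> by a sign-reversing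
  involution on the summands of \<open>e\<^bsub>Q\<^sub>i\<^esub>\<close> (\<open>wedge_e_comp_eq_0\<close>). Otherwise the blocks of \<open>P\<close> are unions
  of blocks \<open>Q\<^sub>i\<close>, thus given by a set composition \<open>T\<close> of the labels, and \<open>P\<close> only rearranges the
  factors of \<open>e\<^sub>Q\<close> (\<open>wedge_e_comp_eq_reorder\<close>). Linear independence of the \<open>e\<^sub>\<sigma>\<close> is visible from the
  coefficients of the set compositions of length \<open>k\<close>.

  On the side of \<open>U\<^sub>l\<close> the permutations that are minimal in their cosets are those which increase on
  the blocks of \<open>r\<close>; they correspond to the set compositions of type \<open>r\<close>
  (\<open>bij_betw_min_coset_reps\<close>). Hence \<open>\<Xi>\<^sup>r\<close> sends a word to the sum of all its rearrangements by set
  compositions of type \<open>r\<close>. This operator is the convolution product of the projections onto the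
  homogeneous components of degrees \<open>r\<^sub>1, r\<^sub>2, \<dots>\<close>, formed with the coproduct for which the letters are
  primitive (\<open>polya_\<Xi>_eq_conv_proj\<close>). Lie monomials are primitive as well, so that the convolution
  acts on a product of Lie monomials exactly as it does on a word
  (\<open>conv_proj_product_of_primitives\<close>).

  The module axioms hold for \<open>\<Lambda>\<^sub>Q\<close> because \<open>\<and>\<close> is associative, and they carry over to \<open>U\<^sub>l\<close> along the
  isomorphism (\<open>\<B>_module_isomorphicI\<close>).
\<close>


section \<open>Linear maps between spaces with a basis\<close>

abbreviation lin :: "(('a \<Rightarrow>\<^sub>0 'f::field) \<Rightarrow> ('b \<Rightarrow>\<^sub>0 'f)) \<Rightarrow> bool" where
  "lin \<equiv> Vector_Spaces.linear pscale pscale"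

interpretation pmp: vector_space_pair
  "pscale :: 'f::field \<Rightarrow> ('a \<Rightarrow>\<^sub>0 'f) \<Rightarrow> ('a \<Rightarrow>\<^sub>0 'f)"
  "pscale :: 'f::field \<Rightarrow> ('b \<Rightarrow>\<^sub>0 'f) \<Rightarrow> ('b \<Rightarrow>\<^sub>0 'f)"
  by unfold_locales

lemma linI:
  assumes "\<And>x y. f (x + y) = f x + f y" and "\<And>c x. f (pscale c x) = pscale c (f x)"
  shows "lin f"
  using assms by (simp add: linear_iff_module_hom module_hom_iff pm.module_axioms)

lemmas lin_add = pmp.linear_add
lemmas lin_scale = pmp.linear_scale
lemmas lin_sum = pmp.linear_sum

lemma lin_comp: "lin f \<Longrightarrow> lin g \<Longrightarrow> lin (\<lambda>x. f (g x))"
  by (rule linI) (simp_all add: lin_add lin_scale)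

lemma lin_combination: "(\<And>i. i \<in> I \<Longrightarrow> lin (f i)) \<Longrightarrow> lin (\<lambda>x. \<Sum>i\<in>I. pscale (c i) (f i x))"
  by (intro pmp.linear_compose_sum ballI pmp.linear_compose_scale_right) auto

lemma pscale_single [simp]: "pscale c (Poly_Mapping.single a d) = Poly_Mapping.single a (c * d)"
  by (rule poly_mapping_eqI) (simp add: lookup_single when_def)

lemma sum_singles: "(\<Sum>a\<in>Poly_Mapping.keys f. Poly_Mapping.single a (Poly_Mapping.lookup f a)) = f"
  by (rule poly_mapping_eqI)
    (auto simp: lookup_sum lookup_single when_def sum.delta in_keys_iff)

lemma linear_ext_superset:
  assumes "finite K" "Poly_Mapping.keys f \<subseteq> K"
  shows "linear_ext m f = (\<Sum>a\<in>K. pscale (Poly_Mapping.lookup f a) (m a))"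
  unfolding linear_ext_def
  by (rule sum.mono_neutral_left) (use assms in \<open>auto simp: in_keys_iff\<close>)

lemma lin_linear_ext [simp, intro]: "lin (linear_ext (m :: 'a \<Rightarrow> 'b \<Rightarrow>\<^sub>0 'f::field))"
proof (rule linI)
  fix x y :: "'a \<Rightarrow>\<^sub>0 'f"
  let ?K = "Poly_Mapping.keys x \<union> Poly_Mapping.keys y"
  have K: "finite ?K" "Poly_Mapping.keys x \<subseteq> ?K" "Poly_Mapping.keys y \<subseteq> ?K"
    "Poly_Mapping.keys (x + y) \<subseteq> ?K"
    using Poly_Mapping.keys_add[of x y] by auto
  show "linear_ext m (x + y) = linear_ext m x + linear_ext m y"
    using K by (simp add: linear_ext_superset[of ?K] lookup_add pm.scale_left_distrib sum.distrib)
next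
  fix c :: 'f and x :: "'a \<Rightarrow>\<^sub>0 'f"
  have K: "Poly_Mapping.keys (pscale c x) \<subseteq> Poly_Mapping.keys x"
    by (auto simp: in_keys_iff)
  show "linear_ext m (pscale c x) = pscale c (linear_ext m x)"
    using K by (simp add: linear_ext_superset[of "Poly_Mapping.keys x"] pm.scale_sum_right)
qed

lemma linear_ext_single [simp]: "linear_ext m (Poly_Mapping.single a c) = pscale c (m a)"
  by (simp add: linear_ext_superset[of "{a}"])

text \<open>Only the basis elements that occur in \<open>u\<close> matter. This is used for maps that agree on the words of
  a fixed length or on the set compositions of a fixed set, but not everywhere.\<close>

lemma lin_eqI:
  assumes "lin f" "lin g"
    and "\<And>a. a \<in> Poly_Mapping.keys u \<Longrightarrow> f (Poly_Mapping.single a 1) = g (Poly_Mapping.single a 1)"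
  shows "f u = g u"
proof -
  have u: "u = (\<Sum>a\<in>Poly_Mapping.keys u. pscale (Poly_Mapping.lookup u a) (Poly_Mapping.single a 1))"
    by (simp add: sum_singles)
  show ?thesis
    by (subst (1 2) u) (simp add: lin_sum lin_scale assms del: pscale_single cong: sum.cong)
qed

lemma lin_bilinear_ext_right [simp, intro]: "lin (bilinear_ext m f)"
  unfolding bilinear_ext_def linear_ext_def[of "\<lambda>a. linear_ext (m a) _" f for m f]
  by (rule lin_combination) simp

lemma lin_bilinear_ext_left [simp, intro]: "lin (\<lambda>f. bilinear_ext m f g)"
  unfolding bilinear_ext_def by simp

lemma bilinear_ext_single [simp]:
  "bilinear_ext m (Poly_Mapping.single a c) (Poly_Mapping.single b d) = pscale (c * d) (m a b)"
  by (simp add: bilinear_ext_def)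

lemma times_eq_bilinear_ext:
  "f * g = bilinear_ext (\<lambda>a b. Poly_Mapping.single (a + b) 1) f (g :: 'a::monoid_add \<Rightarrow>\<^sub>0 'f::field)"
proof -
  have "f * g = (\<Sum>a\<in>Poly_Mapping.keys f. Poly_Mapping.single a (Poly_Mapping.lookup f a)) *
      (\<Sum>b\<in>Poly_Mapping.keys g. Poly_Mapping.single b (Poly_Mapping.lookup g b))"
    by (simp only: sum_singles)
  also have "\<dots> = bilinear_ext (\<lambda>a b. Poly_Mapping.single (a + b) 1) f g"
    by (simp add: bilinear_ext_def linear_ext_def sum_product mult_single pm.scale_sum_right)
  finally show ?thesis .
qed

lemma lin_times_right [simp, intro]: "lin ((*) (f :: 'a::monoid_add \<Rightarrow>\<^sub>0 'f::field))"
  using lin_bilinear_ext_right[of "\<lambda>a b. Poly_Mapping.single (a + b) 1" f]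
  by (simp add: times_eq_bilinear_ext[abs_def])

lemma lin_times_left [simp, intro]: "lin (\<lambda>f. f * (g :: 'a::monoid_add \<Rightarrow>\<^sub>0 'f::field))"
  using lin_bilinear_ext_left[of "\<lambda>a b. Poly_Mapping.single (a + b) 1" g]
  by (simp add: times_eq_bilinear_ext[abs_def])

text \<open>Behind all algebra homomorphisms below: multiplicativity of a linear map has to be checked on
  basis elements only.\<close>

lemma linear_ext_mult:
  fixes m :: "'a::monoid_add \<Rightarrow> 'b::monoid_add \<Rightarrow>\<^sub>0 'f::field"
  assumes "\<And>a b. m (a + b) = m a * m b"
  shows "linear_ext m (f * g) = linear_ext m f * linear_ext m g"
proof (rule lin_eqI[where u = f])
  show "lin (\<lambda>f. linear_ext m (f * g))" "lin (\<lambda>f. linear_ext m f * linear_ext m g)"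
    by (rule lin_comp; simp)+
  fix a
  show "linear_ext m (Poly_Mapping.single a 1 * g) = linear_ext m (Poly_Mapping.single a 1) * linear_ext m g"
  proof (rule lin_eqI[where u = g])
    show "lin (\<lambda>g. linear_ext m (Poly_Mapping.single a 1 * g))"
      "lin (\<lambda>g. linear_ext m (Poly_Mapping.single a 1) * linear_ext m g)"
      by (rule lin_comp; simp)+
  qed (simp add: mult_single assms)
qed

text \<open>The coordinates at the \<open>p j\<close> form a family dual to \<open>f\<close>.\<close>

lemma independent_family_by_lookup:
  fixes f :: "'i \<Rightarrow> 'a \<Rightarrow>\<^sub>0 'f::field"
  assumes fin: "finite I"
    and L: "\<And>i j. i \<in> I \<Longrightarrow> j \<in> I \<Longrightarrow> Poly_Mapping.lookup (f i) (p j) = (if i = j then 1 else 0)"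
  shows "inj_on f I" and "pm.independent (f ` I)"
proof -
  show inj: "inj_on f I"
    by (rule inj_onI) (metis L zero_neq_one)
  show "pm.independent (f ` I)"
  proof (rule pm.independent_if_scalars_zero)
    show "finite (f ` I)" using fin by simp
    fix c x assume "(\<Sum>x\<in>f ` I. pscale (c x) x) = 0" and x: "x \<in> f ` I"
    then have 0: "(\<Sum>i\<in>I. pscale (c (f i)) (f i)) = 0"
      by (simp add: sum.reindex[OF inj])
    obtain j where j: "j \<in> I" "x = f j" using x by blast
    have "0 = Poly_Mapping.lookup (\<Sum>i\<in>I. pscale (c (f i)) (f i)) (p j)"
      by (simp add: 0)
    also have "\<dots> = (\<Sum>i\<in>I. if i = j then c (f i) else 0)"
      unfolding lookup_sum by (rule sum.cong) (simp_all add: L j)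
    also have "\<dots> = c x" using j fin by simp
    finally show "c x = 0" by simp
  qed
qed


section \<open>Products of set compositions\<close>

text \<open>The list of the \<open>B \<inter> C\<close>, with empty sets deleted: what \<open>R\<close> leaves on the set \<open>B\<close>. In
  \<open>P \<and> R\<close> the set composition \<open>R\<close> enters only through its traces on the blocks of \<open>P\<close>.\<close>

definition traces :: "'a set \<Rightarrow> 'a set list \<Rightarrow> 'a set list" where
  "traces B R = filter (\<lambda>C. C \<noteq> {}) (map (\<lambda>C. B \<inter> C) R)"

lemma traces_simps [simp]:
  "traces B [] = []"
  "traces B (C # R) = (if B \<inter> C = {} then traces B R else (B \<inter> C) # traces B R)"
  "traces B (R @ S) = traces B R @ traces B S"
  by (simp_all add: traces_def)

lemma traces_concat: "traces B (concat Rs) = concat (map (traces B) Rs)"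
  by (induction Rs) auto

lemma traces_empty [simp]: "traces {} R = []"
  by (induction R) auto

lemma traces_traces: "traces B (traces C R) = traces (B \<inter> C) R"
  by (induction R) (auto simp: Int_assoc)

lemma Union_set_traces: "\<Union>(set (traces B R)) = B \<inter> \<Union>(set R)"
  by (induction R) auto

lemma wedge_basis_eq: "wedge_basis P R = concat (map (\<lambda>B. traces B R) P)"
  by (simp add: wedge_basis_def traces_def filter_concat o_def)

lemma wedge_basis_assoc:
  "wedge_basis (wedge_basis P R) T = wedge_basis P (wedge_basis R T)"
proof -
  have "concat (map (\<lambda>C. traces C T) (traces B R)) = traces B (concat (map (\<lambda>C. traces C T) R))" for B
    by (induction R) (auto simp: traces_traces)
  then have "concat (map (\<lambda>C. traces C T) (concat (map (\<lambda>B. traces B R) P))) =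
      concat (map (\<lambda>B. traces B (concat (map (\<lambda>C. traces C T) R))) P)"
    by (induction P) auto
  then show ?thesis by (simp add: wedge_basis_eq)
qed

text \<open>Pairwise disjointness in the form \<^const>\<open>sorted_wrt\<close>, which unfolds along the list.\<close>

lemma set_compositions_iff:
  "P \<in> set_compositions A \<longleftrightarrow>
     {} \<notin> set P \<and> \<Union>(set P) = A \<and> sorted_wrt (\<lambda>B C. B \<inter> C = {}) P"
proof -
  have "(\<forall>i<length P. \<forall>j<length P. i \<noteq> j \<longrightarrow> P ! i \<inter> P ! j = {}) \<longleftrightarrow>
      sorted_wrt (\<lambda>B C. B \<inter> C = {}) P"
  proof
    assume R: "sorted_wrt (\<lambda>B C. B \<inter> C = {}) P"
    show "\<forall>i<length P. \<forall>j<length P. i \<noteq> j \<longrightarrow> P ! i \<inter> P ! j = {}"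
    proof (intro allI impI)
      fix i j assume "i < length P" "j < length P" "i \<noteq> j"
      then show "P ! i \<inter> P ! j = {}"
        using sorted_wrt_nth_less[OF R, of i j] sorted_wrt_nth_less[OF R, of j i]
        by (cases "i < j") (auto simp: Int_commute)
    qed
  qed (auto simp: sorted_wrt_iff_nth_less)
  then show ?thesis unfolding set_compositions_def by blast
qed

lemma set_compositions_Nil: "[] \<in> set_compositions A \<longleftrightarrow> A = {}"
  by (auto simp: set_compositions_iff)

lemma set_compositions_Cons:
  "B # P \<in> set_compositions A \<longleftrightarrow> B \<noteq> {} \<and> B \<subseteq> A \<and> P \<in> set_compositions (A - B)"
  by (auto simp: set_compositions_iff)

lemma set_compositions_disjoint:
  assumes "P \<in> set_compositions A" "B \<in> set P" "C \<in> set P" "B \<noteq> C"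
  shows "B \<inter> C = {}"
proof -
  obtain i j where "i < length P" "j < length P" "P ! i = B" "P ! j = C"
    using assms(2,3) by (auto simp: in_set_conv_nth)
  moreover from this have "i \<noteq> j" using assms(4) by auto
  ultimately show ?thesis using assms(1) by (auto simp: set_compositions_def)
qed

lemma set_compositions_append:
  assumes "P \<in> set_compositions A" "R \<in> set_compositions B" "A \<inter> B = {}"
  shows "P @ R \<in> set_compositions (A \<union> B)"
  using assms
proof (induction P arbitrary: A)
  case (Cons C P)
  have "A \<union> B - C = (A - C) \<union> B" "(A - C) \<inter> B = {}"
    using Cons.prems by (auto simp: set_compositions_Cons)
  then show ?case using Cons by (auto simp: set_compositions_Cons)
qed (simp add: set_compositions_Nil)

lemma comp_type_in_compositions:
  assumes P: "P \<in> set_compositions {1..n}"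
  shows "comp_type P \<in> compositions n"
proof -
  have fin: "finite B" if "B \<in> set P" for B
  proof -
    have "B \<subseteq> {1..n}" using that P by (auto simp: set_compositions_iff)
    then show ?thesis by (rule finite_subset) simp
  qed
  have pos: "\<forall>s\<in>set (comp_type P). 0 < s"
    using P fin by (auto simp: comp_type_def set_compositions_iff card_gt_0_iff)
  have "pairwise disjnt (set P)"
    using set_compositions_disjoint[OF P] by (auto simp: pairwise_def disjnt_def)
  then have "card (\<Union>(set P)) = (\<Sum>B\<in>set P. card B)"
    by (rule card_Union_disjoint) (use fin in auto)
  moreover have "distinct P"
    using P unfolding set_compositions_def distinct_conv_nth
    by (metis (mono_tags, lifting) Int_absorb mem_Collect_eq nth_mem)
  ultimately have "sum_list (comp_type P) = n"
    using P by (simp add: comp_type_def set_compositions_iff sum_list_distinct_conv_sum_set)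
  then show ?thesis using pos by (simp add: compositions_def)
qed

lemma traces_eq_self: "{} \<notin> set R \<Longrightarrow> \<Union>(set R) \<subseteq> A \<Longrightarrow> traces A R = R"
proof (induction R)
  case (Cons C R)
  then have "A \<inter> C = C" by auto
  then show ?case using Cons by auto
qed simp

lemma traces_eq_Nil: "\<Union>(set R) \<inter> A = {} \<Longrightarrow> traces A R = []"
  by (induction R) auto

lemma wedge_basis_in_set_compositions:
  assumes "P \<in> set_compositions A" "R \<in> set_compositions A"
  shows "wedge_basis P R \<in> set_compositions A"
proof -
  have tr: "sorted_wrt (\<lambda>B C. B \<inter> C = {}) (traces B R)" for B
  proof -
    have "sorted_wrt (\<lambda>B C. B \<inter> C = {}) R" using assms(2) by (simp add: set_compositions_iff)
    then show ?thesis
    proof (induction R)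
      case (Cons C R)
      have "\<Union>(set (traces B R)) \<subseteq> \<Union>(set R)" by (simp add: Union_set_traces)
      then show ?case using Cons by fastforce
    qed simp
  qed
  have sub: "C \<subseteq> B" if "C \<in> set (traces B R)" for B C
    using that by (auto simp: traces_def)
  have "sorted_wrt (\<lambda>B C. B \<inter> C = {}) P" using assms(1) by (simp add: set_compositions_iff)
  then have "sorted_wrt (\<lambda>B C. B \<inter> C = {}) (wedge_basis P R)"
    unfolding wedge_basis_eq
  proof (induction P)
    case (Cons B P)
    have "C \<inter> D = {}" if "C \<in> set (traces B R)" "B' \<in> set P" "D \<in> set (traces B' R)" for C D B'
    proof -
      have "B \<inter> B' = {}" using Cons.prems that(2) by auto
      then show ?thesis using sub[OF that(1)] sub[OF that(3)] by blast
    qed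
    then show ?case using Cons by (auto simp: sorted_wrt_append tr)
  qed simp
  moreover have "\<Union>(set (wedge_basis P R)) = \<Union>(set P) \<inter> \<Union>(set R)"
    unfolding wedge_basis_eq by (induction P) (auto simp: Union_set_traces)
  moreover have "{} \<notin> set (wedge_basis P R)"
    by (auto simp: wedge_basis_def)
  ultimately show ?thesis using assms by (simp add: set_compositions_iff)
qed

lemma wedge_basis_image:
  assumes "inj \<pi>"
  shows "wedge_basis (map ((`) \<pi>) P) (map ((`) \<pi>) R) = map ((`) \<pi>) (wedge_basis P R)"
proof -
  have "traces (\<pi> ` B) (map ((`) \<pi>) R) = map ((`) \<pi>) (traces B R)" for B
    by (induction R) (simp_all flip: image_Int[OF assms])
  then show ?thesis unfolding wedge_basis_eq by (induction P) auto
qed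

lemma wedge_basis_one:
  assumes "R \<in> set_compositions A"
  shows "wedge_basis [A] R = R"
  using assms by (simp add: wedge_basis_eq set_compositions_iff traces_eq_self)

lemma lin_wedge_right [simp, intro]: "lin (wedge f)"
  by (simp add: wedge_def)

lemma lin_wedge_left [simp, intro]: "lin (\<lambda>f. wedge f g)"
  by (simp add: wedge_def)

lemma wedge_single [simp]:
  "wedge (Poly_Mapping.single P c) (Poly_Mapping.single R d) =
     Poly_Mapping.single (wedge_basis P R) (c * d)"
  by (simp add: wedge_def)

lemma wedge_assoc: "wedge (wedge f g) h = wedge f (wedge g (h :: _ \<Rightarrow>\<^sub>0 'f::field))"
proof (rule lin_eqI[where u = f])
  fix P
  show "wedge (wedge (Poly_Mapping.single P 1) g) h = wedge (Poly_Mapping.single P 1) (wedge g h)"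
  proof (rule lin_eqI[where u = g])
    fix R
    show "wedge (wedge (Poly_Mapping.single P 1) (Poly_Mapping.single R 1)) h =
        wedge (Poly_Mapping.single P 1) (wedge (Poly_Mapping.single R 1) h)"
      by (rule lin_eqI[where u = h])
        (simp_all add: wedge_basis_assoc lin_comp[OF lin_wedge_right lin_wedge_right])
  qed (rule lin_comp[OF lin_wedge_left lin_wedge_right] lin_comp[OF lin_wedge_right lin_wedge_left])+
qed (rule lin_comp[OF lin_wedge_left lin_wedge_left] lin_wedge_left)+

lemma subspace_F\<Pi>: "pm.subspace (F\<Pi> A)"
  unfolding pm.subspace_def F\<Pi>_def
  by (auto simp: in_keys_iff lookup_add subset_iff) (metis add_0)

lemma single_in_F\<Pi>: "P \<in> set_compositions A \<Longrightarrow> Poly_Mapping.single P c \<in> F\<Pi> A"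
  by (simp add: F\<Pi>_def)

lemma lin_image_in_subspace:
  assumes "lin f" "pm.subspace V"
    and "\<And>a. a \<in> Poly_Mapping.keys u \<Longrightarrow> f (Poly_Mapping.single a 1) \<in> V"
  shows "f u \<in> V"
proof -
  have "f u = linear_ext (\<lambda>a. f (Poly_Mapping.single a 1)) u"
    by (rule lin_eqI) (simp_all add: assms)
  also have "\<dots> \<in> V"
    unfolding linear_ext_def using assms(2,3) by (intro pm.subspace_sum pm.subspace_scale)
  finally show ?thesis .
qed

lemma wedge_in_F\<Pi>:
  assumes "f \<in> F\<Pi> A" "g \<in> F\<Pi> A"
  shows "wedge f g \<in> F\<Pi> A"
proof (rule lin_image_in_subspace[where f = "\<lambda>f. wedge f g" and u = f])
  fix P assume P: "P \<in> Poly_Mapping.keys f"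
  show "wedge (Poly_Mapping.single P 1) g \<in> F\<Pi> A"
  proof (rule lin_image_in_subspace[where u = g])
    fix R assume "R \<in> Poly_Mapping.keys g"
    then show "wedge (Poly_Mapping.single P 1) (Poly_Mapping.single R 1) \<in> F\<Pi> A"
      using P assms by (auto intro!: single_in_F\<Pi> wedge_basis_in_set_compositions simp: F\<Pi>_def)
  qed (simp_all add: subspace_F\<Pi>)
qed (simp_all add: subspace_F\<Pi>)

text \<open>Only \<open>n = 0\<close> is special: the unit is then the empty set composition and not \<open>[{}]\<close>.\<close>

lemma \<B>_one_wedge:
  assumes "f \<in> F\<Pi> {1..n}"
  shows "wedge (\<B>_one n) f = f"
proof (rule lin_eqI[where u = f and g = "\<lambda>f. f"])
  fix P assume "P \<in> Poly_Mapping.keys f"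
  then have "P \<in> set_compositions {1..n}" using assms by (auto simp: F\<Pi>_def)
  then show "wedge (\<B>_one n) (Poly_Mapping.single P 1) = Poly_Mapping.single P 1"
    using wedge_basis_one[of P "{1..n}"]
    by (cases "n = 0"; cases P) (auto simp: \<B>_one_def wedge_basis_eq set_compositions_Nil set_compositions_Cons)
qed (auto intro: linI)

lemma lin_perm_act [simp, intro]: "lin (perm_act \<pi>)"
  by (simp add: perm_act_def)

lemma perm_act_single [simp]:
  "perm_act \<pi> (Poly_Mapping.single P c) = Poly_Mapping.single (map ((`) \<pi>) P) c"
  by (simp add: perm_act_def)

lemma perm_act_wedge:
  assumes "inj \<pi>"
  shows "perm_act \<pi> (wedge f g) = wedge (perm_act \<pi> f) (perm_act \<pi> g)"
proof (rule lin_eqI[where u = f])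
  fix P
  show "perm_act \<pi> (wedge (Poly_Mapping.single P 1) g) =
      wedge (perm_act \<pi> (Poly_Mapping.single P 1)) (perm_act \<pi> g)"
    by (rule lin_eqI[where u = g]) (simp_all add: wedge_basis_image assms lin_comp[OF lin_wedge_right lin_perm_act]
        lin_comp[OF lin_perm_act lin_wedge_right])
qed (rule lin_comp[OF lin_perm_act lin_wedge_left] lin_comp[OF lin_wedge_left lin_perm_act])+

lemma subspace_\<B>: "pm.subspace (\<B> n)"
  unfolding \<B>_def
  using subspace_F\<Pi>[of "{1..n}"]
  by (auto simp: pm.subspace_def lin_add lin_scale pmp.linear_0)

lemma wedge_in_\<B>: "b \<in> \<B> n \<Longrightarrow> c \<in> \<B> n \<Longrightarrow> wedge b c \<in> \<B> n"
  by (auto simp: \<B>_def wedge_in_F\<Pi> perm_act_wedge permutes_inj)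

lemma \<B>_one_in_\<B>: "\<B>_one n \<in> \<B> n"
  by (auto simp: \<B>_def \<B>_one_def permutes_image set_compositions_iff intro!: single_in_F\<Pi>)


section \<open>The elements \<open>e\<^sub>Q\<close>\<close>

abbreviation min_first :: "nat set \<Rightarrow> nat set list set" where
  "min_first A \<equiv> {R \<in> set_compositions A. Min A \<in> R ! 0}"

abbreviation length_sign :: "'a list \<Rightarrow> 'f::field" where
  "length_sign R \<equiv> (-1) ^ (length R - 1)"

text \<open>The families \<open>\<rho>\<close> of summands are indexed by labels, not by positions, so that a
  rearrangement of the blocks does not change the range of the summation or the signs.\<close>

lemma e_comp_map:
  assumes "distinct xs" "\<forall>i\<in>set xs. finite (Q i)" "disjoint_family_on Q (set xs)"
  shows "(e_comp (map Q xs) :: _ \<Rightarrow>\<^sub>0 'f::field) =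
    (\<Sum>\<rho> \<in> (\<Pi>\<^sub>E i\<in>set xs. min_first (Q i)).
       Poly_Mapping.single (concat (map \<rho> xs)) (\<Prod>i\<in>set xs. length_sign (\<rho> i)))"
  using assms
proof (induction xs)
  case Nil
  show ?case by (simp add: e_comp_def)
next
  case (Cons x xs)
  let ?E = "\<lambda>i. min_first (Q i)"
  let ?PI = "\<Pi>\<^sub>E i\<in>set xs. ?E i"
  let ?s = "\<lambda>\<rho>. (\<Prod>i\<in>set xs. length_sign (\<rho> i)) :: 'f"
  have x: "x \<notin> set xs" using Cons.prems by simp
  have U: "\<Union>(set (concat (map \<rho> xs))) = (\<Union>i\<in>set xs. Q i)" if "\<rho> \<in> ?PI" for \<rho>
  proof -
    have "\<Union>(set (\<rho> i)) = Q i" if "i \<in> set xs" for i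
      using \<open>\<rho> \<in> ?PI\<close> that by (auto simp: PiE_iff set_compositions_iff)
    then show ?thesis by fastforce
  qed
  have disj: "\<Union>(set R) \<inter> \<Union>(set (concat (map \<rho> xs))) = {}" if "R \<in> ?E x" "\<rho> \<in> ?PI" for R \<rho>
    using that(1) Cons.prems(3) x unfolding U[OF that(2)] disjoint_family_on_def
    by (auto simp: set_compositions_iff)
  have lv: "lin (vee f)" "lin (\<lambda>f. vee f g)" for f g :: "nat set list \<Rightarrow>\<^sub>0 'f"
    by (simp_all add: vee_def)
  have IH: "(e_comp (map Q xs) :: _ \<Rightarrow>\<^sub>0 'f) = (\<Sum>\<rho>\<in>?PI. Poly_Mapping.single (concat (map \<rho> xs)) (?s \<rho>))"
    using Cons by (auto simp: disjoint_family_on_def)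
  have "(e_comp (map Q (x # xs)) :: _ \<Rightarrow>\<^sub>0 'f) = vee (e_set (Q x)) (e_comp (map Q xs))"
    by (simp add: e_comp_def)
  also have "\<dots> = (\<Sum>R\<in>?E x. \<Sum>\<rho>\<in>?PI. vee (Poly_Mapping.single R (length_sign R))
      (Poly_Mapping.single (concat (map \<rho> xs)) (?s \<rho>)))"
    unfolding IH e_set_def lin_sum[OF lv(2)] by (simp add: lin_sum[OF lv(1)])
  also have "\<dots> = (\<Sum>R\<in>?E x. \<Sum>\<rho>\<in>?PI. Poly_Mapping.single (R @ concat (map \<rho> xs)) (length_sign R * ?s \<rho>))"
    by (intro sum.cong refl) (simp add: vee_def if_P[OF disj] del: set_concat)
  also have "\<dots> = (\<Sum>(R, \<rho>)\<in>?E x \<times> ?PI. Poly_Mapping.single (R @ concat (map \<rho> xs)) (length_sign R * ?s \<rho>))"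
    by (simp add: sum.cartesian_product)
  also have "\<dots> = (\<Sum>(R, \<rho>)\<in>?E x \<times> ?PI. Poly_Mapping.single (concat (map (\<rho>(x := R)) (x # xs)))
      (\<Prod>i\<in>set (x # xs). length_sign ((\<rho>(x := R)) i)))"
  proof (intro sum.cong refl, clarify)
    fix R \<rho>
    have "(\<Prod>i\<in>set xs. length_sign ((\<rho>(x := R)) i)) = ?s \<rho>"
      using x by (intro prod.cong) auto
    moreover have "map (\<rho>(x := R)) xs = map \<rho> xs" using x by auto
    ultimately show "Poly_Mapping.single (R @ concat (map \<rho> xs)) (length_sign R * ?s \<rho>) =
        Poly_Mapping.single (concat (map (\<rho>(x := R)) (x # xs))) (\<Prod>i\<in>set (x # xs). length_sign ((\<rho>(x := R)) i))"
      using x by simp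
  qed
  also have "\<dots> = (\<Sum>\<rho>\<in>(\<lambda>(R, \<rho>). \<rho>(x := R)) ` (?E x \<times> ?PI).
      Poly_Mapping.single (concat (map \<rho> (x # xs))) (\<Prod>i\<in>set (x # xs). length_sign (\<rho> i)))"
    by (subst sum.reindex[OF inj_combinator[OF x]]) (simp add: case_prod_unfold)
  finally show ?case by (simp add: PiE_insert_eq)
qed

lemma e_comp_in_F\<Pi>:
  assumes xs: "distinct xs" "\<forall>i\<in>set xs. finite (Q i)" "disjoint_family_on Q (set xs)"
  shows "e_comp (map Q xs) \<in> F\<Pi> (\<Union>(Q ` set xs))"
proof -
  have "concat (map \<rho> xs) \<in> set_compositions (\<Union>(Q ` set xs))"
    if "\<rho> \<in> (\<Pi>\<^sub>E i\<in>set xs. min_first (Q i))" for \<rho>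
  proof -
    have "\<rho> i \<in> set_compositions (Q i)" if "i \<in> set xs" for i
      using PiE_mem[OF \<open>\<rho> \<in> _\<close> that] by simp
    then show ?thesis using xs(1,3)
    proof (induction xs)
      case (Cons x xs)
      have "Q x \<inter> Q i = {}" if "i \<in> set xs" for i
        using disjoint_family_onD[OF Cons.prems(3), of x i] Cons.prems(2) that by auto
      then have "Q x \<inter> \<Union>(Q ` set xs) = {}" by blast
      moreover have "concat (map \<rho> xs) \<in> set_compositions (\<Union>(Q ` set xs))"
        using Cons disjoint_family_on_mono[OF set_subset_Cons Cons.prems(3)] by auto
      ultimately show ?case
        using set_compositions_append[of "\<rho> x" "Q x"] Cons.prems(1) by simp
    qed (simp add: set_compositions_Nil)
  qed
  then show ?thesis
    unfolding e_comp_map[OF xs] by (intro pm.subspace_sum[OF subspace_F\<Pi>] single_in_F\<Pi>)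
qed

text \<open>The involution that cancels the summands of \<open>e\<^sub>A\<close> when \<open>A\<close> is split by a set \<open>C\<close>. At the first
  block that meets \<open>C\<close>, it either cuts this block into its parts outside and inside \<open>C\<close>, in this
  order, or, if the block lies inside \<open>C\<close>, merges it into its predecessor, which avoids \<open>C\<close>. A
  predecessor exists if the first block of the list is not contained in \<open>C\<close>. The length changes by
  one, while the traces on \<open>C\<close> and on any set disjoint from \<open>C\<close> stay the same.\<close>

fun toggle :: "'a set \<Rightarrow> 'a set list \<Rightarrow> 'a set list" where
  "toggle C [] = []"
| "toggle C [B] = (if B \<inter> C = {} then [B] else [B - C, B \<inter> C])"
| "toggle C (B # B' # R) =
     (if B \<inter> C \<noteq> {} then (B - C) # (B \<inter> C) # B' # R
      else if B' \<subseteq> C then (B \<union> B') # R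
      else B # toggle C (B' # R))"

lemma toggle_eq_Nil [simp]: "toggle C R = [] \<longleftrightarrow> R = []"
  by (induction C R rule: toggle.induct) auto

text \<open>Elements outside \<open>C\<close> do not leave the first block; this applies to the minimum, whose
  position is prescribed in \<^const>\<open>e_set\<close>.\<close>

lemma hd_toggle: "hd R - C \<subseteq> hd (toggle C R)"
  by (induction C R rule: toggle.induct) auto

lemma toggle_in_set_compositions:
  assumes "R \<in> set_compositions A" "R \<noteq> []" "\<not> hd R \<subseteq> C"
  shows "toggle C R \<in> set_compositions A"
  using assms
proof (induction C R arbitrary: A rule: toggle.induct)
  case (3 C B B' R)
  show ?case
  proof (cases "B \<inter> C = {} \<and> \<not> B' \<subseteq> C")
    case True
    then show ?thesis using 3 by (simp add: set_compositions_Cons)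
  next
    case False
    have "A - (B - C) - (B \<inter> C) = A - B" "A - B - B' = A - (B \<union> B')" by auto
    then show ?thesis using 3(2-) False by (auto simp: set_compositions_Cons)
  qed
qed (auto simp: set_compositions_Cons set_compositions_Nil)

lemma toggle_toggle:
  assumes "R \<in> set_compositions A" "R \<noteq> []" "\<not> hd R \<subseteq> C"
  shows "toggle C (toggle C R) = R"
  using assms
proof (induction C R arbitrary: A rule: toggle.induct)
  case (2 C B)
  have "B - C \<union> B \<inter> C = B" by auto
  then show ?case using 2 by auto
next
  case (3 C B B' R)
  show ?case
  proof (cases "B \<inter> C = {} \<and> \<not> B' \<subseteq> C")
    case True
    have "\<not> hd (toggle C (B' # R)) \<subseteq> C" using hd_toggle[of "B' # R" C] True by auto
    moreover have "toggle C (toggle C (B' # R)) = B' # R"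
      using 3(1)[of "A - B"] 3(2) True by (simp add: set_compositions_Cons)
    ultimately show ?thesis using True
      by (cases "toggle C (B' # R)") auto
  next
    case False
    have ne: "B \<noteq> {}" "B' \<noteq> {}" using 3(2) by (auto simp: set_compositions_Cons)
    have *: "B - C \<union> B \<inter> C = B" by auto
    show ?thesis
    proof (cases "B \<inter> C = {}")
      case True
      then have B': "B' \<subseteq> C" using False by simp
      then have "(B \<union> B') \<inter> C = B'" "B \<union> B' - C = B" using True by auto
      then show ?thesis using True B' ne by (cases R) auto
    next
      case F: False
      then show ?thesis using * by auto
    qed
  qed
qed auto

lemma length_sign_toggle:
  assumes "R \<noteq> []" "\<not> hd R \<subseteq> C" "\<Union>(set R) \<inter> C \<noteq> {}"
  shows "length_sign (toggle C R) = - (length_sign R :: 'f::field)"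
  using assms
proof (induction C R rule: toggle.induct)
  case (3 C B B' R)
  show ?case
  proof (cases "B \<inter> C = {} \<and> \<not> B' \<subseteq> C")
    case True
    moreover have "\<Union>(set (B' # R)) \<inter> C \<noteq> {}" using True 3(4) by auto
    ultimately have "length_sign (toggle C (B' # R)) = - (length_sign (B' # R) :: 'f)"
      using 3(1) by simp
    then show ?thesis using True by (cases "toggle C (B' # R)") auto
  qed auto
qed auto

lemma traces_toggle:
  assumes "R \<noteq> []" "\<not> hd R \<subseteq> C" "D = C \<or> D \<inter> C = {}"
  shows "traces D (toggle C R) = traces D R"
  using assms
proof (induction C R rule: toggle.induct)
  case (2 C B)
  then consider "D = C" | "D \<inter> (B - C) = D \<inter> B" "D \<inter> (B \<inter> C) = {}" by blast
  then show ?case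
  proof cases
    case 1
    have "C \<inter> (B - C) = {}" "C \<inter> (B \<inter> C) = C \<inter> B" by auto
    then show ?thesis using 1 by auto
  qed simp
next
  case (3 C B B' R)
  show ?case
  proof (cases "B \<inter> C = {} \<and> \<not> B' \<subseteq> C")
    case True
    then show ?thesis using 3 by simp
  next
    case False
    show ?thesis
    proof (cases "D = C")
      case True
      have "B \<inter> C = {} \<Longrightarrow> C \<inter> (B \<union> B') = C \<inter> B'" "C \<inter> (B - C) = {}" "C \<inter> (B \<inter> C) = C \<inter> B"
        "C \<inter> B = {} \<longleftrightarrow> B \<inter> C = {}" by auto
      then show ?thesis using True False by auto
    next
      case ne: False
      then have "B' \<subseteq> C \<Longrightarrow> D \<inter> (B \<union> B') = D \<inter> B" "B' \<subseteq> C \<Longrightarrow> D \<inter> B' = {}"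
         "D \<inter> (B - C) = D \<inter> B" "D \<inter> (B \<inter> C) = {}"
        using 3 by auto
      then show ?thesis using False by auto
    qed
  qed
qed auto

text \<open>If no block of \<open>P\<close> contains \<open>Q x\<close>, some block \<open>C\<close> of \<open>P\<close> meets \<open>Q x\<close> but avoids its minimum.
  Toggling the component at \<open>x\<close> with respect to \<open>C\<close> then permutes the summands of \<open>e\<^sub>Q\<close> and
  reverses their signs, but it is invisible to \<open>P\<close>, because the other blocks of \<open>P\<close> are disjoint
  from \<open>C\<close>.\<close>

lemma wedge_e_comp_eq_0:
  assumes xs: "distinct xs" "\<forall>i\<in>set xs. finite (Q i)" "disjoint_family_on Q (set xs)"
    and P: "P \<in> set_compositions A"
    and x: "x \<in> set xs" "Q x \<noteq> {}" "Q x \<subseteq> A" "\<forall>B\<in>set P. \<not> Q x \<subseteq> B"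
  shows "wedge (Poly_Mapping.single P 1) (e_comp (map Q xs)) = (0 :: _ \<Rightarrow>\<^sub>0 'f::field_char_0)"
proof -
  have "Min (Q x) \<in> Q x" using x xs(2) by simp
  then obtain B0 where B0: "B0 \<in> set P" "Min (Q x) \<in> B0"
    using x(3) P by (auto simp: set_compositions_iff)
  \<comment> \<open>\<open>C\<close> is a block of \<open>P\<close> that contains a part of \<open>Q x\<close> away from the minimum\<close>
  obtain y where y: "y \<in> Q x" "y \<notin> B0" using x(4) B0 by blast
  then obtain C where C: "C \<in> set P" "y \<in> C" using x(3) P by (auto simp: set_compositions_iff)
  have PP: "B \<inter> C = {}" if "B \<in> set P" "B \<noteq> C" for B
    using set_compositions_disjoint[OF P that(1) C(1) that(2)] .
  have minC: "Min (Q x) \<notin> C" using PP[OF B0(1)] B0 y C by auto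
  let ?PI = "\<Pi>\<^sub>E i\<in>set xs. min_first (Q i)"
  let ?t = "\<lambda>\<rho>. \<rho>(x := toggle C (\<rho> x))"
  let ?sg = "\<lambda>\<rho>. (\<Prod>i\<in>set xs. length_sign (\<rho> i)) :: 'f"
  let ?f = "\<lambda>\<rho>. Poly_Mapping.single (wedge_basis P (concat (map \<rho> xs))) (?sg \<rho>)"
  have R: "\<rho> x \<noteq> []" "\<not> hd (\<rho> x) \<subseteq> C" "\<rho> x \<in> set_compositions (Q x)" "Min (Q x) \<in> hd (\<rho> x)"
    if "\<rho> \<in> ?PI" for \<rho>
  proof -
    have "\<rho> x \<in> min_first (Q x)" using that x(1) by (auto simp: PiE_iff)
    moreover from this show "\<rho> x \<noteq> []" using x(2) by (auto simp: set_compositions_Nil)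
    ultimately show "\<rho> x \<in> set_compositions (Q x)" "Min (Q x) \<in> hd (\<rho> x)"
      by (simp_all add: hd_conv_nth)
    then show "\<not> hd (\<rho> x) \<subseteq> C" using minC by auto
  qed
  have t: "?t \<rho> \<in> ?PI" "?t (?t \<rho>) = \<rho>" "?f (?t \<rho>) = - ?f \<rho>" if \<rho>: "\<rho> \<in> ?PI" for \<rho>
  proof -
    note BR = R[OF \<rho>]
    have "Min (Q x) \<in> toggle C (\<rho> x) ! 0"
      using hd_toggle[of "\<rho> x" C] BR minC by (auto simp flip: hd_conv_nth)
    then show "?t \<rho> \<in> ?PI"
      using \<rho> x(1) toggle_in_set_compositions[OF BR(3,1,2)] by (auto simp: PiE_iff extensional_def)
    show "?t (?t \<rho>) = \<rho>"
      using toggle_toggle[OF BR(3,1,2)] by auto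
    have "\<Union>(set (\<rho> x)) \<inter> C \<noteq> {}" using BR(3) y C by (auto simp: set_compositions_iff)
    then have s: "length_sign (toggle C (\<rho> x)) = - (length_sign (\<rho> x) :: 'f)"
      by (rule length_sign_toggle[OF BR(1,2)])
    have "?sg (?t \<rho>) = length_sign (toggle C (\<rho> x)) * (\<Prod>i\<in>set xs - {x}. length_sign (?t \<rho> i))"
      using x(1) by (subst prod.remove[of _ x]) auto
    also have "(\<Prod>i\<in>set xs - {x}. length_sign (?t \<rho> i)) = (\<Prod>i\<in>set xs - {x}. length_sign (\<rho> i) :: 'f)"
      by (rule prod.cong) auto
    finally have "?sg (?t \<rho>) = - ?sg \<rho>"
      unfolding s using x(1) by (simp add: prod.remove[of _ x])
    moreover have "traces D (concat (map (?t \<rho>) xs)) = traces D (concat (map \<rho> xs))" if "D \<in> set P" for D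
    proof -
      have "traces D (?t \<rho> i) = traces D (\<rho> i)" for i
        using traces_toggle[OF BR(1,2), of D] PP[OF that] by auto
      then show ?thesis by (simp add: traces_concat o_def del: fun_upd_apply)
    qed
    then have "wedge_basis P (concat (map (?t \<rho>) xs)) = wedge_basis P (concat (map \<rho> xs))"
      unfolding wedge_basis_eq by (intro arg_cong[where f = concat] map_cong refl)
    ultimately show "?f (?t \<rho>) = - ?f \<rho>" by (simp only: single_uminus)
  qed
  have "sum ?f ?PI = (\<Sum>\<rho>\<in>?PI. ?f (?t \<rho>))"
    by (rule sum.reindex_bij_witness[of _ ?t ?t]) (use t in auto)
  also have "\<dots> = - sum ?f ?PI"
    using t(3) by (simp add: sum_negf cong: sum.cong)
  \<comment> \<open>equal to its own negative, the sum vanishes in characteristic zero\<close>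
  finally have "sum ?f ?PI + sum ?f ?PI = 0" by (simp only: eq_neg_iff_add_eq_0)
  then have "pscale 2 (sum ?f ?PI) = 0"
    using pm.scale_left_distrib[of 1 1 "sum ?f ?PI"] by simp
  then have "sum ?f ?PI = 0" by simp
  then show ?thesis
    by (simp add: e_comp_map[OF xs] lin_sum[OF lin_wedge_right])
qed


section \<open>Rearrangements of the blocks\<close>

text \<open>The counterpart of \<open>T \<and> \<sigma>\<close> for a word \<open>\<sigma>\<close> without repetitions, considered as a set
  composition into singletons.\<close>

definition reorder :: "'a set list \<Rightarrow> 'a list \<Rightarrow> 'a list" where
  "reorder T xs = concat (map (\<lambda>B. filter (\<lambda>i. i \<in> B) xs) T)"

text \<open>Removing the letters of the first block before the others are treated matches the recursion
  of \<^term>\<open>set_compositions A\<close>, in which the tail is a set composition of the complement \<open>A - B\<close>.\<close>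

lemma reorder_Cons:
  assumes "\<forall>C\<in>set T. B \<inter> C = {}"
  shows "reorder (B # T) xs = filter (\<lambda>i. i \<in> B) xs @ reorder T (filter (\<lambda>i. i \<notin> B) xs)"
proof -
  have "filter (\<lambda>i. i \<in> C) xs = filter (\<lambda>i. i \<in> C) (filter (\<lambda>i. i \<notin> B) xs)" if "C \<in> set T" for C
    unfolding filter_filter by (rule filter_cong[OF refl]) (use assms that in blast)
  then have "map (\<lambda>C. filter (\<lambda>i. i \<in> C) xs) T = map (\<lambda>C. filter (\<lambda>i. i \<in> C) (filter (\<lambda>i. i \<notin> B) xs)) T"
    by (intro map_cong refl)
  then show ?thesis by (simp only: reorder_def list.map concat.simps)
qed

lemma set_reorder:
  assumes "T \<in> set_compositions (set xs)"
  shows "set (reorder T xs) = set xs"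
  using assms by (auto simp: reorder_def set_compositions_iff)

lemma distinct_reorder:
  assumes "T \<in> set_compositions (set xs)" "distinct xs"
  shows "distinct (reorder T xs)"
  using assms
proof (induction T arbitrary: xs)
  case (Cons B T)
  let ?xs = "filter (\<lambda>i. i \<notin> B) xs"
  have r: "reorder (B # T) xs = filter (\<lambda>i. i \<in> B) xs @ reorder T ?xs"
    using Cons.prems(1) by (intro reorder_Cons) (auto simp: set_compositions_iff)
  have "set ?xs = set xs - B" by auto
  then have T: "T \<in> set_compositions (set ?xs)"
    using Cons.prems(1) by (simp add: set_compositions_Cons)
  show ?case
    unfolding r distinct_append set_reorder[OF T] using Cons.IH[OF T] Cons.prems(2) by auto
qed (simp add: reorder_def)

text \<open>Every ordering is thus a rearrangement of any other one; on the side of \<open>\<Lambda>\<^sub>Q\<close> this makes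
  all the \<open>e\<^sub>\<sigma>\<close> elements of the same left ideal.\<close>

lemma reorder_singletons:
  assumes "distinct xs" "set xs = set ys"
  shows "reorder (map (\<lambda>i. {i}) ys) xs = ys"
proof -
  have "filter (\<lambda>i. i = y) xs = [y]" if "y \<in> set xs" for y
    using assms(1) that by (induction xs) (auto simp: filter_empty_conv)
  then have "concat (map (\<lambda>y. filter (\<lambda>i. i = y) xs) zs) = zs" if "set zs \<subseteq> set xs" for zs
    using that by (induction zs) auto
  then show ?thesis using assms(2) by (simp add: reorder_def o_def)
qed

lemma singletons_in_set_compositions:
  assumes "distinct ys"
  shows "map (\<lambda>i. {i}) ys \<in> set_compositions (set ys)"
proof -
  have "sorted_wrt (\<lambda>B C. B \<inter> C = {}) (map (\<lambda>i. {i}) ys)"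
    using assms by (induction ys) auto
  then show ?thesis by (auto simp: set_compositions_iff simp del: sorted_wrt_map)
qed

text \<open>On a union of blocks \<open>Q j\<close>, a set composition of \<open>Q i\<close> leaves either its full trace or none, so
  that the components of each summand of \<open>e\<^sub>Q\<close> are permuted as wholes.\<close>

lemma wedge_e_comp_eq_reorder:
  assumes xs: "distinct xs" "\<forall>i\<in>set xs. finite (Q i)" "disjoint_family_on Q (set xs)"
    and T: "T \<in> set_compositions (set xs)"
  shows "wedge (Poly_Mapping.single (map (\<lambda>B. \<Union>(Q ` B)) T) 1) (e_comp (map Q xs)) =
    (e_comp (map Q (reorder T xs)) :: _ \<Rightarrow>\<^sub>0 'f::field)"
proof -
  let ?P = "map (\<lambda>B. \<Union>(Q ` B)) T"
  have *: "wedge_basis ?P (concat (map \<rho> xs)) = concat (map \<rho> (reorder T xs))"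
    if \<rho>: "\<rho> \<in> (\<Pi>\<^sub>E i\<in>set xs. min_first (Q i))" for \<rho>
  proof -
    have "traces (\<Union>(Q ` B)) (\<rho> i) = (if i \<in> B then \<rho> i else [])" if "i \<in> set xs" "B \<in> set T" for i B
    proof -
      have B: "B \<subseteq> set xs" using T that by (auto simp: set_compositions_iff)
      have \<rho>i: "{} \<notin> set (\<rho> i)" "\<Union>(set (\<rho> i)) = Q i"
        using PiE_mem[OF \<rho> that(1)] by (auto simp: set_compositions_iff)
      show ?thesis
      proof (cases "i \<in> B")
        case True
        then have "Q i \<subseteq> \<Union>(Q ` B)" by blast
        then show ?thesis using True traces_eq_self[OF \<rho>i(1)] by (simp add: \<rho>i(2))
      next
        case False
        have "Q i \<inter> Q j = {}" if "j \<in> B" for j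
          using disjoint_family_onD[OF xs(3) \<open>i \<in> set xs\<close>, of j] B that False by auto
        then have "Q i \<inter> \<Union>(Q ` B) = {}" by blast
        then show ?thesis using False by (simp add: traces_eq_Nil \<rho>i)
      qed
    qed
    then have "traces (\<Union>(Q ` B)) (concat (map \<rho> zs)) = concat (map \<rho> (filter (\<lambda>i. i \<in> B) zs))"
      if "B \<in> set T" "set zs \<subseteq> set xs" for B zs
      using that by (induction zs) auto
    then have "wedge_basis ?P (concat (map \<rho> xs)) =
        concat (map (\<lambda>B. concat (map \<rho> (filter (\<lambda>i. i \<in> B) xs))) T)"
      unfolding wedge_basis_eq map_map o_def by (intro arg_cong[where f = concat] map_cong refl) auto
    moreover have "concat (map (\<lambda>B. concat (map \<rho> (f B))) T) = concat (map \<rho> (concat (map f T)))" for f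
      by (induction T) auto
    ultimately show ?thesis by (simp only: reorder_def)
  qed
  have d: "distinct (reorder T xs)" and s: "set (reorder T xs) = set xs"
    using distinct_reorder[OF T xs(1)] set_reorder[OF T] .
  have "wedge (Poly_Mapping.single ?P 1) (e_comp (map Q xs)) =
      (\<Sum>\<rho>\<in>(\<Pi>\<^sub>E i\<in>set xs. min_first (Q i)).
         Poly_Mapping.single (concat (map \<rho> (reorder T xs))) (\<Prod>i\<in>set xs. length_sign (\<rho> i) :: 'f))"
    by (subst e_comp_map[OF xs]) (simp_all only: lin_sum[OF lin_wedge_right] wedge_single * mult_1_left cong: sum.cong)
  also have "\<dots> = e_comp (map Q (reorder T xs))"
    by (simp only: e_comp_map[OF d, of Q, unfolded s, OF xs(2,3)])
  finally show ?thesis .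
qed

text \<open>A set composition in which no \<open>Q i\<close> is split amounts to a set composition of the labels: two labels
  belong to a common block if the blocks of these labels are merged.\<close>

lemma
  fixes Q :: "nat \<Rightarrow> nat set"
  assumes fin: "\<forall>i\<in>I. finite (Q i)" and df: "disjoint_family_on Q I" and ne: "\<forall>i\<in>I. Q i \<noteq> {}"
  shows inj_on_merge_blocks: "inj_on (map (\<lambda>B. \<Union>(Q ` B))) (set_compositions I)"
    and image_merge_blocks: "map (\<lambda>B. \<Union>(Q ` B)) ` set_compositions I =
      {P \<in> set_compositions (\<Union>(Q ` I)). \<forall>i\<in>I. \<exists>B\<in>set P. Q i \<subseteq> B}"
    and comp_type_merge_blocks: "finite I \<Longrightarrow> T \<in> set_compositions I \<Longrightarrow>
      comp_type (map (\<lambda>B. \<Union>(Q ` B)) T) = map (\<lambda>B. \<Sum>i\<in>B. card (Q i)) T"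
proof -
  let ?A = "\<Union>(Q ` I)"
  let ?u = "map (\<lambda>B. \<Union>(Q ` B))"
  let ?t = "\<lambda>C. {i \<in> I. Q i \<subseteq> C}"
  have disj: "i = j" if "i \<in> I" "j \<in> I" "a \<in> Q i" "a \<in> Q j" for i j a
    using df that unfolding disjoint_family_on_def by blast
  have sub: "B \<subseteq> I" if "T \<in> set_compositions I" "B \<in> set T" for B T
    using that by (auto simp: set_compositions_iff)
  have tu: "?t (\<Union>(Q ` B)) = B" if "B \<subseteq> I" for B
  proof
    show "?t (\<Union>(Q ` B)) \<subseteq> B"
    proof safe
      fix i assume i: "i \<in> I" "Q i \<subseteq> \<Union>(Q ` B)"
      then obtain a where "a \<in> Q i" using ne by blast
      then obtain j where "j \<in> B" "a \<in> Q j" using i by blast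
      then show "i \<in> B" using disj[OF i(1), of j a] \<open>a \<in> Q i\<close> \<open>B \<subseteq> I\<close> by auto
    qed
  qed (use that in auto)
  have ut: "\<Union>(Q ` ?t C) = C"
    if P: "P \<in> set_compositions ?A" "\<forall>i\<in>I. \<exists>B\<in>set P. Q i \<subseteq> B" "C \<in> set P" for P C
  proof
    show "C \<subseteq> \<Union>(Q ` ?t C)"
    proof
      fix a assume a: "a \<in> C"
      then have "a \<in> ?A" using P by (auto simp: set_compositions_iff)
      then obtain i where i: "i \<in> I" "a \<in> Q i" by blast
      then obtain B where B: "B \<in> set P" "Q i \<subseteq> B" using P(2) by blast
      then have "B = C" using set_compositions_disjoint[OF P(1) B(1) P(3)] a i by blast
      then show "a \<in> \<Union>(Q ` ?t C)" using i B by auto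
    qed
  qed auto
  show "inj_on ?u (set_compositions I)"
  proof (rule inj_on_inverseI[where g = "map ?t"])
    fix T assume "T \<in> set_compositions I"
    then have "\<forall>B\<in>set T. B \<subseteq> I" by (auto simp: set_compositions_iff)
    then show "map ?t (?u T) = T" by (simp add: tu map_idI)
  qed
  show "?u ` set_compositions I = {P \<in> set_compositions ?A. \<forall>i\<in>I. \<exists>B\<in>set P. Q i \<subseteq> B}"
  proof (intro equalityI subsetI)
    fix P assume "P \<in> ?u ` set_compositions I"
    then obtain T where T: "T \<in> set_compositions I" "P = ?u T" by auto
    have "{} \<notin> set P"
    proof
      assume "{} \<in> set P"
      then obtain B where B: "B \<in> set T" "\<Union>(Q ` B) = {}" unfolding T(2) by auto
      then obtain i where "i \<in> B" using T(1) by (metis set_compositions_iff ex_in_conv)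
      moreover from this have "i \<in> I" using sub[OF T(1) B(1)] by blast
      ultimately show False using B ne by blast
    qed
    moreover have "\<Union>(set P) = ?A"
    proof -
      have "\<Union>(set P) = (\<Union>i\<in>\<Union>(set T). Q i)" unfolding T(2) by auto
      also have "\<Union>(set T) = I" using T(1) by (simp add: set_compositions_iff)
      finally show ?thesis .
    qed
    moreover have "sorted_wrt (\<lambda>B C. B \<inter> C = {}) P"
      unfolding T(2) sorted_wrt_map
    proof (rule sorted_wrt_mono_rel)
      show "sorted_wrt (\<lambda>B C. B \<inter> C = {}) T" using T(1) by (simp add: set_compositions_iff)
      fix B C assume BC: "B \<in> set T" "C \<in> set T" "B \<inter> C = {}"
      show "\<Union>(Q ` B) \<inter> \<Union>(Q ` C) = {}"
      proof (rule equals0I)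
        fix a assume "a \<in> \<Union>(Q ` B) \<inter> \<Union>(Q ` C)"
        then obtain i j where "i \<in> B" "a \<in> Q i" "j \<in> C" "a \<in> Q j" by blast
        moreover from this have "i = j"
          using disj[of i j a] sub[OF T(1) BC(1)] sub[OF T(1) BC(2)] by auto
        ultimately show False using BC(3) by auto
      qed
    qed
    moreover have "\<exists>B\<in>set P. Q i \<subseteq> B" if "i \<in> I" for i
    proof -
      have "i \<in> \<Union>(set T)" using T(1) that by (simp add: set_compositions_iff)
      then show ?thesis using T(2) by auto
    qed
    ultimately show "P \<in> {P \<in> set_compositions ?A. \<forall>i\<in>I. \<exists>B\<in>set P. Q i \<subseteq> B}"
      by (simp add: set_compositions_iff)
  next
    fix P assume "P \<in> {P \<in> set_compositions ?A. \<forall>i\<in>I. \<exists>B\<in>set P. Q i \<subseteq> B}"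
    then have P: "P \<in> set_compositions ?A" "\<forall>i\<in>I. \<exists>B\<in>set P. Q i \<subseteq> B" by auto
    have PT: "?u (map ?t P) = P" using ut[OF P] by (simp add: map_idI)
    have "?t C \<noteq> {}" if "C \<in> set P" for C
    proof
      assume "?t C = {}"
      then have "C = {}" using ut[OF P that] by (simp only: image_empty Sup_empty)
      then show False using that P(1) by (simp add: set_compositions_iff)
    qed
    then have "{} \<notin> set (map ?t P)" unfolding set_map by (metis (lifting) imageE)
    moreover have "\<Union>(set (map ?t P)) = I" using P(2) by auto
    moreover have "sorted_wrt (\<lambda>B C. B \<inter> C = {}) (map ?t P)"
      unfolding sorted_wrt_map
    proof (rule sorted_wrt_mono_rel)
      show "sorted_wrt (\<lambda>B C. B \<inter> C = {}) P" using P(1) by (simp add: set_compositions_iff)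
      fix B C assume BC: "B \<in> set P" "C \<in> set P" "B \<inter> C = {}"
      show "?t B \<inter> ?t C = {}"
      proof (rule equals0I)
        fix i assume "i \<in> ?t B \<inter> ?t C"
        then have "i \<in> I" "Q i \<subseteq> B \<inter> C" by auto
        then show False using ne BC(3) by auto
      qed
    qed
    ultimately have "map ?t P \<in> set_compositions I" by (simp add: set_compositions_iff)
    then show "P \<in> ?u ` set_compositions I" using PT by (intro image_eqI[of _ _ "map ?t P"]) auto
  qed
  assume I: "finite I" and T: "T \<in> set_compositions I"
  have "card (\<Union>(Q ` B)) = (\<Sum>i\<in>B. card (Q i))" if "B \<in> set T" for B
  proof (rule card_UN_disjoint)
    show "\<forall>i\<in>B. \<forall>j\<in>B. i \<noteq> j \<longrightarrow> Q i \<inter> Q j = {}"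
      using disjoint_family_on_mono[OF sub[OF T that] df] by (simp add: disjoint_family_on_def)
  qed (use sub[OF T that] fin I in \<open>auto intro: finite_subset\<close>)
  then show "comp_type (?u T) = map (\<lambda>B. \<Sum>i\<in>B. card (Q i)) T"
    by (simp add: comp_type_def)
qed

text \<open>The set compositions that split some \<open>Q i\<close> contribute nothing; the others are parametrized by
  the set compositions \<open>T\<close> of the labels.\<close>

lemma X_elt_wedge_e_comp:
  assumes xs: "distinct xs" "\<forall>i\<in>set xs. finite (Q i)" "disjoint_family_on Q (set xs)"
    and ne: "\<forall>i\<in>set xs. Q i \<noteq> {}" and U: "\<Union>(Q ` set xs) = {1..sum_list r}"
  shows "wedge (X_elt r) (e_comp (map Q xs)) =
    (\<Sum>T\<in>{T \<in> set_compositions (set xs). map (\<lambda>B. \<Sum>i\<in>B. card (Q i)) T = r}.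
       e_comp (map Q (reorder T xs)) :: _ \<Rightarrow>\<^sub>0 'f::field_char_0)"
proof -
  let ?A = "{1..sum_list r}"
  let ?u = "map (\<lambda>B. \<Union>(Q ` B))"
  let ?P = "{P \<in> set_compositions ?A. comp_type P = r}"
  let ?T = "{T \<in> set_compositions (set xs). map (\<lambda>B. \<Sum>i\<in>B. card (Q i)) T = r}"
  have inj: "inj_on ?u ?T"
    by (rule inj_on_subset[OF inj_on_merge_blocks[OF xs(2,3) ne]]) auto
  have img: "?u ` ?T = {P \<in> ?P. \<forall>i\<in>set xs. \<exists>B\<in>set P. Q i \<subseteq> B}"
  proof -
    have "?u ` ?T = {P \<in> ?u ` set_compositions (set xs). comp_type P = r}"
      using comp_type_merge_blocks[OF xs(2,3) ne] by auto
    then show ?thesis unfolding image_merge_blocks[OF xs(2,3) ne] U by auto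
  qed
  have fin: "finite ?P" by (simp add: finite_set_compositions)
  have "wedge (X_elt r) (e_comp (map Q xs)) =
      (\<Sum>P\<in>?P. wedge (Poly_Mapping.single P 1) (e_comp (map Q xs)) :: _ \<Rightarrow>\<^sub>0 'f)"
    unfolding X_elt_def by (rule lin_sum[OF lin_wedge_left])
  also have "\<dots> = (\<Sum>P\<in>?u ` ?T. wedge (Poly_Mapping.single P 1) (e_comp (map Q xs)))"
  proof (rule sum.mono_neutral_right[OF fin])
    show "?u ` ?T \<subseteq> ?P" unfolding img by auto
    show "\<forall>P\<in>?P - ?u ` ?T. wedge (Poly_Mapping.single P 1) (e_comp (map Q xs)) = (0 :: _ \<Rightarrow>\<^sub>0 'f)"
    proof
      fix P assume "P \<in> ?P - ?u ` ?T"
      then obtain i where "P \<in> set_compositions ?A" "i \<in> set xs" "\<forall>B\<in>set P. \<not> Q i \<subseteq> B"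
        unfolding img by blast
      moreover from this have "Q i \<noteq> {}" "Q i \<subseteq> ?A" using U ne by auto
      ultimately show "wedge (Poly_Mapping.single P 1) (e_comp (map Q xs)) = (0 :: _ \<Rightarrow>\<^sub>0 'f)"
        by (intro wedge_e_comp_eq_0[OF xs])
    qed
  qed
  also have "\<dots> = (\<Sum>T\<in>?T. wedge (Poly_Mapping.single (?u T) 1) (e_comp (map Q xs)))"
    by (simp add: sum.reindex[OF inj])
  also have "\<dots> = (\<Sum>T\<in>?T. e_comp (map Q (reorder T xs)))"
    by (rule sum.cong) (auto simp: wedge_e_comp_eq_reorder[OF xs])
  finally show ?thesis .
qed

text \<open>A summand of \<open>e\<^sub>Q\<close> has at least one block for each factor, and exactly one for each factor only
  if it is \<open>Q\<close> itself. The \<open>e\<^sub>\<sigma>\<close> are therefore dual to the coordinates at the rearrangements of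
  \<open>Q\<close>.\<close>

lemma lookup_e_comp:
  assumes xs: "distinct xs" "\<forall>i\<in>set xs. finite (Q i)" "disjoint_family_on Q (set xs)"
    and ne: "\<forall>i\<in>set xs. Q i \<noteq> {}" and ys: "distinct ys" "set ys = set xs"
  shows "Poly_Mapping.lookup (e_comp (map Q xs) :: _ \<Rightarrow>\<^sub>0 'f::field) (map Q ys) = (if xs = ys then 1 else 0)"
proof -
  let ?PI = "\<Pi>\<^sub>E i\<in>set xs. min_first (Q i)"
  let ?\<rho> = "\<lambda>i\<in>set xs. [Q i]"
  have inj: "inj_on Q (set xs)"
  proof (rule inj_onI)
    fix i j assume ij: "i \<in> set xs" "j \<in> set xs" "Q i = Q j"
    show "i = j"
    proof (rule ccontr)
      assume "i \<noteq> j"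
      then have "Q i \<inter> Q j = {}" using disjoint_family_onD[OF xs(3)] ij(1,2) by blast
      then show False using ij ne by simp
    qed
  qed
  have \<rho>0: "?\<rho> \<in> ?PI" using xs(2) ne by (auto simp: set_compositions_Cons set_compositions_Nil)
  have cc: "concat (map ?\<rho> xs) = map Q xs"
  proof -
    have "map ?\<rho> xs = map (\<lambda>i. [Q i]) xs" by simp
    then show ?thesis by (simp only: concat_map_singleton)
  qed
  have lone: "\<rho> = ?\<rho>" if \<rho>: "\<rho> \<in> ?PI" and eq: "concat (map \<rho> xs) = map Q ys" for \<rho>
  proof -
    have R: "\<rho> i \<in> set_compositions (Q i)" if "i \<in> set xs" for i
      using \<rho> that by (auto simp: PiE_iff)
    have pos: "1 \<le> length (\<rho> i)" if "i \<in> set xs" for i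
      using R[OF that] ne that by (cases "\<rho> i") (auto simp: set_compositions_Nil)
    have "(\<Sum>i\<in>set xs. length (\<rho> i)) = length (concat (map \<rho> xs))"
      using xs(1) by (simp add: length_concat sum_list_distinct_conv_sum_set o_def)
    also have "\<dots> = (\<Sum>i\<in>set xs. 1)"
      using ys xs(1) by (simp add: eq distinct_card[symmetric])
    finally have "length (\<rho> i) = 1" if "i \<in> set xs" for i
      using sum_mono_inv[of "\<lambda>_. 1" "set xs" "\<lambda>i. length (\<rho> i)" i] pos that by simp
    then have "\<rho> i = [Q i]" if "i \<in> set xs" for i
      using R[OF that] that
      by (cases "\<rho> i") (fastforce simp: set_compositions_Cons set_compositions_Nil)+
    then show ?thesis using \<rho> by (auto simp: PiE_iff extensional_def fun_eq_iff)
  qed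
  have fin: "finite ?PI"
    using xs(2) by (intro finite_PiE) (auto simp: finite_set_compositions)
  have "Poly_Mapping.lookup (e_comp (map Q xs) :: _ \<Rightarrow>\<^sub>0 'f) (map Q ys) =
     (\<Sum>\<rho>\<in>?PI. if \<rho> = ?\<rho> then (if xs = ys then 1 else 0) else 0)"
    unfolding e_comp_map[OF xs] lookup_sum
  proof (rule sum.cong[OF refl])
    fix \<rho> assume \<rho>: "\<rho> \<in> ?PI"
    have "map Q xs = map Q ys \<longleftrightarrow> xs = ys"
      using inj ys by (intro inj_on_map_eq_map) auto
    then show "Poly_Mapping.lookup (Poly_Mapping.single (concat (map \<rho> xs)) (\<Prod>i\<in>set xs. length_sign (\<rho> i))) (map Q ys) =
      (if \<rho> = ?\<rho> then (if xs = ys then 1 else 0) else (0 :: 'f))"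
      using lone[OF \<rho>] cc by (auto simp: lookup_single when_def)
  qed
  also have "\<dots> = (if xs = ys then 1 else 0)"
    by (rule trans[OF sum.delta[OF fin]], rule if_P[OF \<rho>0])
  finally show ?thesis .
qed


section \<open>The coproduct of the free associative algebra\<close>

text \<open>The tensor square of the free associative algebra: it is the monoid
  algebra of the pairs of words under componentwise concatenation.\<close>

type_synonym ('x, 'f) tensor_square = "('x free_monoid \<times> 'x free_monoid) \<Rightarrow>\<^sub>0 'f"

text \<open>The embeddings \<open>a \<mapsto> a \<otimes> 1\<close> and \<open>a \<mapsto> 1 \<otimes> a\<close>; hence \<open>a \<otimes> b\<close> is \<open>left a * right b\<close>.\<close>

definition left :: "('x, 'f::field) free_algebra \<Rightarrow> ('x, 'f) tensor_square" where
  "left = linear_ext (\<lambda>w. Poly_Mapping.single (w, 0) 1)"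

definition right :: "('x, 'f::field) free_algebra \<Rightarrow> ('x, 'f) tensor_square" where
  "right = linear_ext (\<lambda>w. Poly_Mapping.single (0, w) 1)"

text \<open>The algebra homomorphism for which the letters are primitive, that is, the unshuffle
  coproduct.\<close>

definition coprod :: "('x, 'f::field) free_algebra \<Rightarrow> ('x, 'f) tensor_square" where
  "coprod = linear_ext (\<lambda>w. \<Prod>x\<leftarrow>letters w. left (gen x) + right (gen x))"

lemma lin_left [simp, intro]: "lin left" and lin_right [simp, intro]: "lin right"
  and lin_coprod [simp, intro]: "lin coprod"
  by (simp_all add: left_def right_def coprod_def)

lemma left_single [simp]: "left (Poly_Mapping.single w c) = Poly_Mapping.single (w, 0) c"
  and right_single [simp]: "right (Poly_Mapping.single w c) = Poly_Mapping.single (0, w) c"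
  by (simp_all add: left_def right_def)

lemma letters_simps [simp]: "letters (u + v) = letters u @ letters v" "letters 0 = []"
  by (simp_all add: plus_free_monoid_def zero_free_monoid_def)

lemma left_mult: "left (a * b) = left a * left b"
  and right_mult: "right (a * b) = right a * right b"
  and coprod_mult: "coprod (a * b) = coprod a * coprod b"
  unfolding left_def right_def coprod_def
  by (rule linear_ext_mult; simp add: mult_single)+

lemma left_one [simp]: "left 1 = 1" and right_one [simp]: "right 1 = 1"
  and coprod_one [simp]: "coprod 1 = 1"
  by (simp_all add: coprod_def zero_prod_def flip: single_one)

lemma left_right_commute: "right b * left a = left a * right (b :: ('x, 'f::field) free_algebra)"
proof (rule lin_eqI[where u = a])
  show "lin (\<lambda>a. right b * left a)" "lin (\<lambda>a. left a * right b)"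
    by (rule lin_comp[OF lin_times_right lin_left] lin_comp[OF lin_times_left lin_left])+
  fix v
  show "right b * left (Poly_Mapping.single v 1) = left (Poly_Mapping.single v 1) * right b"
  proof (rule lin_eqI[where u = b])
    show "lin (\<lambda>b. right b * left (Poly_Mapping.single v 1))"
      "lin (\<lambda>b. left (Poly_Mapping.single v 1) * right b)"
      by (rule lin_comp[OF lin_times_right lin_right] lin_comp[OF lin_times_left lin_right])+
  qed (simp add: mult_single)
qed

definition primitive :: "('x, 'f::field) free_algebra \<Rightarrow> bool" where
  "primitive a \<longleftrightarrow> coprod a = left a + right a"

lemma primitive_gen: "primitive (gen x)"
  by (simp add: primitive_def coprod_def gen_def)

text \<open>The mixed terms cancel since the two embeddings commute.\<close>

lemma primitive_lie_bracket:
  assumes "primitive a" "primitive b"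
  shows "primitive (lie_bracket a b)"
proof -
  have d: "left (u - v) = left u - left v" "right (u - v) = right u - right v"
    "coprod (u - v) = coprod u - coprod v" for u v :: "('a, 'b) free_algebra"
    by (simp_all add: pmp.linear_diff)
  show ?thesis
    using assms
    by (simp add: primitive_def lie_bracket_def d left_mult right_mult coprod_mult
        algebra_simps left_right_commute)
qed

lemma primitive_lie_monomial: "a \<in> lie_monomials \<Longrightarrow> primitive a"
  by (induction rule: lie_monomials.induct) (simp_all add: primitive_gen primitive_lie_bracket)

abbreviation list_product :: "('i \<Rightarrow> 'a::monoid_mult) \<Rightarrow> 'i list \<Rightarrow> 'a" where
  "list_product f xs \<equiv> prod_list (map f xs)"

text \<open>Expand the product of the sums \<open>left (f i) + right (f i)\<close>: \<open>B\<close> is the set of factors for which the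
  left summand is chosen, and commuting the left past the right factors sorts each term.\<close>

lemma coprod_product_of_primitives:
  assumes "distinct xs" "\<forall>i\<in>set xs. primitive (f i)"
  shows "coprod (list_product f xs) =
    (\<Sum>B\<in>Pow (set xs). left (list_product f (filter (\<lambda>i. i \<in> B) xs)) *
       right (list_product f (filter (\<lambda>i. i \<notin> B) xs)))"
  using assms
proof (induction xs)
  case (Cons x xs)
  let ?g = "\<lambda>xs B. left (list_product f (filter (\<lambda>i. i \<in> B) xs)) *
       right (list_product f (filter (\<lambda>i. i \<notin> B) xs))"
  have x: "x \<notin> set xs" using Cons.prems by simp
  have fl: "filter (\<lambda>i. i \<in> insert x B) xs = filter (\<lambda>i. i \<in> B) xs"
    "filter (\<lambda>i. i \<notin> insert x B) xs = filter (\<lambda>i. i \<notin> B) xs" for B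
    using x by (auto intro!: filter_cong)
  have 1: "?g (x # xs) (insert x B) = left (f x) * ?g xs B" for B
    using fl[of B] by (simp add: left_mult mult.assoc)
  have 2: "?g (x # xs) B = right (f x) * ?g xs B" if "B \<in> Pow (set xs)" for B
  proof -
    have "x \<notin> B" using that x by auto
    then show ?thesis
      by (simp add: right_mult left_right_commute flip: mult.assoc)
  qed
  have "coprod (list_product f (x # xs)) = (left (f x) + right (f x)) * (\<Sum>B\<in>Pow (set xs). ?g xs B)"
    using Cons by (simp add: coprod_mult primitive_def)
  also have "\<dots> = (\<Sum>B\<in>Pow (set xs). right (f x) * ?g xs B) + (\<Sum>B\<in>Pow (set xs). left (f x) * ?g xs B)"
    unfolding distrib_right sum_distrib_left sum.distrib by (rule add.commute)
  also have "\<dots> = (\<Sum>B\<in>Pow (set xs). ?g (x # xs) B) + (\<Sum>B\<in>Pow (set xs). ?g (x # xs) (insert x B))"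
    unfolding 1 by (simp only: 2 cong: sum.cong)
  also have "(\<Sum>B\<in>Pow (set xs). ?g (x # xs) (insert x B)) = (\<Sum>B\<in>insert x ` Pow (set xs). ?g (x # xs) B)"
    using x by (subst sum.reindex) (auto intro!: inj_onI)
  also have "(\<Sum>B\<in>Pow (set xs). ?g (x # xs) B) + (\<Sum>B\<in>insert x ` Pow (set xs). ?g (x # xs) B) =
      (\<Sum>B\<in>Pow (set xs) \<union> insert x ` Pow (set xs). ?g (x # xs) B)"
    using x by (intro sum.union_disjoint[symmetric]) auto
  also have "Pow (set xs) \<union> insert x ` Pow (set xs) = Pow (set (x # xs))"
    by (simp add: Pow_insert)
  finally show ?case .
qed simp


section \<open>Convolution of the projections onto the homogeneous components\<close>

definition homogeneous_part :: "nat \<Rightarrow> ('x, 'f::field) free_algebra \<Rightarrow> ('x, 'f) free_algebra" where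
  "homogeneous_part s = linear_ext (\<lambda>u. if length (letters u) = s then Poly_Mapping.single u 1 else 0)"

text \<open>The linear map \<open>a \<otimes> b \<mapsto> p\<^sub>s(a) g(b)\<close>, where \<open>p\<^sub>s\<close> is the projection onto degree \<open>s\<close>.\<close>

definition contract ::
    "nat \<Rightarrow> (('x, 'f) free_algebra \<Rightarrow> ('x, 'f) free_algebra) \<Rightarrow>
     ('x, 'f::field) tensor_square \<Rightarrow> ('x, 'f) free_algebra" where
  "contract s g = linear_ext
     (\<lambda>(u, v). homogeneous_part s (Poly_Mapping.single u 1) * g (Poly_Mapping.single v 1))"

text \<open>The convolution product \<open>p\<^bsub>r\<^sub>1\<^esub> * p\<^bsub>r\<^sub>2\<^esub> * \<cdots>\<close> of projections. The empty product is the unit of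
  the convolution, which is \<open>p\<^sub>0\<close>.\<close>

fun conv_proj :: "nat list \<Rightarrow> ('x, 'f::field) free_algebra \<Rightarrow> ('x, 'f) free_algebra" where
  "conv_proj [] = homogeneous_part 0"
| "conv_proj (s # r) = (\<lambda>u. contract s (conv_proj r) (coprod u))"

lemma lin_homogeneous_part [simp, intro]: "lin (homogeneous_part s)"
  and lin_contract [simp, intro]: "lin (contract s g)"
  by (simp_all add: homogeneous_part_def contract_def)

lemma lin_conv_proj [simp, intro]: "lin (conv_proj r)"
proof (cases r)
  case Nil
  then show ?thesis by simp
next
  case (Cons s r')
  then show ?thesis using lin_comp[OF lin_contract lin_coprod] by simp
qed

lemma contract_tensor:
  assumes "lin g"
  shows "contract s g (left a * right b) = homogeneous_part s a * g b"
proof (rule lin_eqI[where u = a])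
  show "lin (\<lambda>a. contract s g (left a * right b))"
    by (rule lin_comp[OF lin_contract lin_comp[OF lin_times_left lin_left]])
  show "lin (\<lambda>a. homogeneous_part s a * g b)"
    by (rule lin_comp[OF lin_times_left lin_homogeneous_part])
  fix v
  show "contract s g (left (Poly_Mapping.single v 1) * right b) =
      homogeneous_part s (Poly_Mapping.single v 1) * g b"
  proof (rule lin_eqI[where u = b])
    show "lin (\<lambda>b. contract s g (left (Poly_Mapping.single v 1) * right b))"
      by (rule lin_comp[OF lin_contract lin_comp[OF lin_times_right lin_right]])
    show "lin (\<lambda>b. homogeneous_part s (Poly_Mapping.single v 1) * g b)"
      by (rule lin_comp[OF lin_times_right assms])
  qed (simp add: mult_single contract_def)
qed

lemma homogeneous_part_eq:
  assumes "a \<in> homogeneous d"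
  shows "homogeneous_part s a = (if d = s then a else 0)"
proof -
  have "homogeneous_part s a =
      (\<Sum>w\<in>Poly_Mapping.keys a. if d = s then Poly_Mapping.single w (Poly_Mapping.lookup a w) else 0)"
    unfolding homogeneous_part_def linear_ext_def
    by (rule sum.cong) (use assms in \<open>auto simp: homogeneous_def\<close>)
  then show ?thesis by (simp add: sum_singles)
qed

lemma homogeneous_mult:
  assumes "a \<in> homogeneous d" "b \<in> homogeneous e"
  shows "a * b \<in> homogeneous (d + e)"
  using assms Poly_Mapping.keys_mult[of a b]
  by (fastforce simp: homogeneous_def plus_free_monoid_def)

lemma homogeneous_one: "1 \<in> homogeneous 0"
  by (simp add: homogeneous_def zero_free_monoid_def flip: single_one)

lemma homogeneous_gen: "gen x \<in> homogeneous 1"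
  by (simp add: homogeneous_def gen_def)

lemma homogeneous_list_product:
  "\<forall>i\<in>set xs. f i \<in> homogeneous (d i) \<Longrightarrow> list_product f xs \<in> homogeneous (\<Sum>i\<leftarrow>xs. d i)"
  by (induction xs) (simp_all add: homogeneous_one homogeneous_mult)

text \<open>By the coproduct formula, peeling off the first projection amounts to the choice of a set \<open>B\<close> of
  labels of total degree \<open>s\<close>, and the remaining projections act on the factors with labels outside
  \<open>B\<close>. Iterated, these choices are the set compositions of the labels. Since \<open>s > 0\<close>, the sets
  \<open>B\<close> are non-empty.\<close>

lemma conv_proj_product_of_primitives:
  assumes "distinct xs" "\<forall>i\<in>set xs. primitive (f i)" "\<forall>i\<in>set xs. f i \<in> homogeneous (d i)"
    and "\<forall>i\<in>set xs. 0 < d i" "\<forall>s\<in>set r. 0 < s"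
  shows "conv_proj r (list_product f xs) =
    (\<Sum>T\<in>{T \<in> set_compositions (set xs). map (\<lambda>B. \<Sum>i\<in>B. d i) T = r}. list_product f (reorder T xs))"
  using assms
proof (induction r arbitrary: xs)
  case Nil
  have h: "list_product f xs \<in> homogeneous (\<Sum>i\<in>set xs. d i)"
    using homogeneous_list_product[OF Nil.prems(3)] Nil.prems(1)
    by (simp add: sum_list_distinct_conv_sum_set)
  have T: "{T \<in> set_compositions (set xs). map (\<lambda>B. \<Sum>i\<in>B. d i) T = []} = (if xs = [] then {[]} else {})"
    by (auto simp: set_compositions_Nil)
  show ?case
    unfolding T conv_proj.simps homogeneous_part_eq[OF h] using Nil.prems(4)
    by (cases xs) (auto simp: reorder_def)
next
  case (Cons s r)
  let ?A = "set xs"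
  let ?d = "\<lambda>B. \<Sum>i\<in>B. d i"
  let ?L = "\<lambda>B. filter (\<lambda>i. i \<in> B) xs" and ?R = "\<lambda>B. filter (\<lambda>i. i \<notin> B) xs"
  let ?T = "\<lambda>A r. {T \<in> set_compositions A. map ?d T = r}"
  have IH: "conv_proj r (list_product f (?R B)) =
      (\<Sum>T\<in>?T (?A - B) r. list_product f (reorder T (?R B)))" for B
  proof -
    have "set (?R B) = ?A - B" by auto
    then show ?thesis using Cons.IH[of "?R B"] Cons.prems by simp
  qed
  have proj: "homogeneous_part s (list_product f (?L B)) = (if ?d B = s then list_product f (?L B) else 0)"
    if "B \<in> Pow ?A" for B
  proof -
    have "list_product f (?L B) \<in> homogeneous (\<Sum>i\<leftarrow>?L B. d i)"
      using Cons.prems(3) by (intro homogeneous_list_product) auto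
    also have "(\<Sum>i\<leftarrow>?L B. d i) = ?d (set (?L B))"
      using Cons.prems(1) by (simp add: sum_list_distinct_conv_sum_set)
    also have "set (?L B) = B" using that by auto
    finally show ?thesis by (rule homogeneous_part_eq)
  qed
  have fin: "finite (?T (?A - B) r)" for B by (simp add: finite_set_compositions)
  have T: "?T ?A (s # r) = (\<lambda>(B, T). B # T) ` (SIGMA B:{B \<in> Pow ?A. ?d B = s}. ?T (?A - B) r)"
  proof (intro equalityI subsetI)
    fix T assume "T \<in> ?T ?A (s # r)"
    then show "T \<in> (\<lambda>(B, T). B # T) ` (SIGMA B:{B \<in> Pow ?A. ?d B = s}. ?T (?A - B) r)"
      by (cases T) (auto simp: set_compositions_Cons)
  next
    fix T assume "T \<in> (\<lambda>(B, T). B # T) ` (SIGMA B:{B \<in> Pow ?A. ?d B = s}. ?T (?A - B) r)"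
    then obtain B T' where "T = B # T'" "B \<subseteq> ?A" "?d B = s" "T' \<in> set_compositions (?A - B)" "map ?d T' = r"
      by auto
    moreover from this have "B \<noteq> {}" using Cons.prems(5) by auto
    ultimately show "T \<in> ?T ?A (s # r)" by (simp add: set_compositions_Cons)
  qed
  have "conv_proj (s # r) (list_product f xs) =
      (\<Sum>B\<in>Pow ?A. homogeneous_part s (list_product f (?L B)) * conv_proj r (list_product f (?R B)))"
    unfolding conv_proj.simps coprod_product_of_primitives[OF Cons.prems(1,2)] lin_sum[OF lin_contract]
    by (simp add: contract_tensor)
  also have "\<dots> = (\<Sum>B\<in>Pow ?A. if ?d B = s then
      (\<Sum>T\<in>?T (?A - B) r. list_product f (?L B @ reorder T (?R B))) else 0)"
    by (rule sum.cong) (simp_all add: proj IH sum_distrib_left)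
  also have "\<dots> = (\<Sum>B\<in>{B \<in> Pow ?A. ?d B = s}. \<Sum>T\<in>?T (?A - B) r. list_product f (?L B @ reorder T (?R B)))"
    by (rule sum.inter_filter[symmetric]) simp
  also have "\<dots> = (\<Sum>(B, T)\<in>(SIGMA B:{B \<in> Pow ?A. ?d B = s}. ?T (?A - B) r).
      list_product f (?L B @ reorder T (?R B)))"
    by (rule sum.Sigma) (simp_all add: fin)
  also have "\<dots> = (\<Sum>(B, T)\<in>(SIGMA B:{B \<in> Pow ?A. ?d B = s}. ?T (?A - B) r). list_product f (reorder (B # T) xs))"
  proof (rule sum.cong[OF refl], clarify)
    fix B T assume "T \<in> set_compositions (?A - B)"
    then have "\<forall>C\<in>set T. B \<inter> C = {}" by (auto simp: set_compositions_iff)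
    then show "list_product f (?L B @ reorder T (?R B)) = list_product f (reorder (B # T) xs)"
      by (simp only: reorder_Cons)
  qed
  also have "\<dots> = (\<Sum>T\<in>?T ?A (s # r). list_product f (reorder T xs))"
    unfolding T by (subst sum.reindex) (simp_all add: inj_on_def case_prod_unfold)
  finally show ?case .
qed


section \<open>Permutations as lists and minimal coset representatives\<close>

abbreviation perm_word :: "nat \<Rightarrow> (nat \<Rightarrow> nat) \<Rightarrow> nat list" where
  "perm_word n \<pi> \<equiv> map \<pi> [1..<Suc n]"

definition orderings :: "nat \<Rightarrow> nat list set" where
  "orderings n = {xs. distinct xs \<and> set xs = {1..n}}"

lemma length_orderings: "xs \<in> orderings n \<Longrightarrow> length xs = n"
  unfolding orderings_def using distinct_card by fastforce

lemma finite_orderings: "finite (orderings n)"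
proof -
  have "orderings n \<subseteq> {xs. set xs \<subseteq> {1..n} \<and> length xs = n}"
    using length_orderings by (auto simp: orderings_def)
  then show ?thesis by (rule finite_subset) (simp add: finite_lists_length_eq)
qed

lemma upt_in_orderings: "[1..<Suc n] \<in> orderings n"
  by (auto simp: orderings_def)

lemma reorder_in_orderings:
  assumes "T \<in> set_compositions {1..n}" "xs \<in> orderings n"
  shows "reorder T xs \<in> orderings n"
  using assms distinct_reorder[of T xs] set_reorder[of T xs] by (simp add: orderings_def)

lemma perm_word_in_orderings: "\<pi> permutes {1..n} \<Longrightarrow> perm_word n \<pi> \<in> orderings n"
proof -
  assume p: "\<pi> permutes {1..n}"
  have "\<pi> ` {1..n} = {1..n}" by (rule permutes_image[OF p])
  moreover have "set [1..<Suc n] = {1..n}" by auto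
  ultimately show ?thesis
    using permutes_inj_on[OF p] by (simp add: orderings_def distinct_map del: upt_Suc)
qed

lemma bij_betw_perm_word: "bij_betw (perm_word n) {\<pi>. \<pi> permutes {1..n}} (orderings n)"
proof -
  let ?f = "\<lambda>xs x. if x \<in> {1..n} then xs ! (x - 1) else x"
  have f: "?f xs permutes {1..n}" "perm_word n (?f xs) = xs" if xs: "xs \<in> orderings n" for xs
  proof -
    have l: "length xs = n" by (rule length_orderings[OF xs])
    have w: "perm_word n (?f xs) = xs"
      by (rule nth_equalityI) (simp_all add: l nth_append del: upt_Suc)
    have "inj_on (?f xs) {1..n}"
      using xs by (auto simp: inj_on_def orderings_def nth_eq_iff_index_eq l)
    moreover have "?f xs ` {1..n} = {1..n}"
    proof -
      have "?f xs ` {1..n} = set (perm_word n (?f xs))" by auto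
      then show ?thesis using xs unfolding w by (simp add: orderings_def)
    qed
    ultimately have "bij_betw (?f xs) {1..n} {1..n}" by (simp add: bij_betw_def)
    then show "?f xs permutes {1..n}" by (rule bij_imp_permutes) auto
    show "perm_word n (?f xs) = xs" by (rule w)
  qed
  show ?thesis
  proof (rule bij_betw_byWitness[where f' = ?f])
    show "\<forall>\<pi>\<in>{\<pi>. \<pi> permutes {1..n}}. ?f (perm_word n \<pi>) = \<pi>"
    proof clarify
      fix \<pi> assume p: "\<pi> permutes {1..n}"
      show "?f (perm_word n \<pi>) = \<pi>"
      proof
        fix x
        have "perm_word n \<pi> ! (x - 1) = \<pi> x" if "x \<in> {1..n}"
          using that nth_map_upt[of "x - 1" "Suc n" 1 \<pi>] by (auto simp del: upt_Suc)
        then show "?f (perm_word n \<pi>) x = \<pi> x"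
          using permutes_not_in[OF p, of x] by (simp del: upt_Suc)
      qed
    qed
    show "perm_word n ` {\<pi>. \<pi> permutes {1..n}} \<subseteq> orderings n"
      by (intro image_subsetI) (simp only: mem_Collect_eq perm_word_in_orderings)
    show "?f ` orderings n \<subseteq> {\<pi>. \<pi> permutes {1..n}}"
      by (intro image_subsetI CollectI f)
  qed (intro ballI f)
qed

lemma upt_eq_concat_blocks:
  "[1..<Suc (sum_list r)] =
     concat (map (\<lambda>i. [Suc (sum_list (take i r))..<Suc (sum_list (take (Suc i) r))]) [0..<length r])"
proof (induction r rule: rev_induct)
  case (snoc s r)
  have "[1..<Suc (sum_list (r @ [s]))] = [1..<Suc (sum_list r)] @ [Suc (sum_list r)..<Suc (sum_list r + s)]"
    using upt_add_eq_append[of 1 "Suc (sum_list r)" s] by (simp del: upt_Suc)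
  also have "[1..<Suc (sum_list r)] = concat (map (\<lambda>i. [Suc (sum_list (take i (r @ [s])))..<
      Suc (sum_list (take (Suc i) (r @ [s])))]) [0..<length r])"
    unfolding snoc.IH by (intro arg_cong[where f = concat] map_cong refl) (simp del: upt_Suc)
  finally show ?case by (simp del: upt_Suc) simp
qed simp

lemma young_block_eq: "{Suc (sum_list (take i r))..<Suc (sum_list (take (Suc i) r))} = young_block r i"
  by (auto simp: young_block_def)

lemma sum_list_take_mono: "i \<le> j \<Longrightarrow> sum_list (take i r) \<le> sum_list (take j (r :: nat list))"
  by (metis le_add1 le_add_diff_inverse sum_list_append take_add)

lemma young_block_unique:
  assumes "x \<in> young_block r i" "x \<in> young_block r j"
  shows "i = j"
proof -
  have "\<not> i < j" if "x \<in> young_block r i" "x \<in> young_block r j" for i j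
  proof
    assume "i < j"
    then have "sum_list (take (Suc i) r) \<le> sum_list (take j r)" by (intro sum_list_take_mono) simp
    then show False using that by (auto simp: young_block_def)
  qed
  then show ?thesis using assms by (meson linorder_neqE_nat)
qed

lemma young_block_subset: "young_block r i \<subseteq> {1..sum_list r}"
proof -
  have "sum_list (take (Suc i) r) \<le> sum_list r"
    using sum_list_take_mono[of "Suc i" "max (Suc i) (length r)" r] by simp
  then show ?thesis by (auto simp: young_block_def)
qed

text \<open>Stated for neighbours, which is the form in which it follows from minimality.\<close>

definition increasing_on_blocks :: "nat list \<Rightarrow> (nat \<Rightarrow> nat) \<Rightarrow> bool" where
  "increasing_on_blocks r \<pi> \<longleftrightarrow>
     (\<forall>i<length r. \<forall>j. j \<in> young_block r i \<and> Suc j \<in> young_block r i \<longrightarrow> \<pi> j < \<pi> (Suc j))"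

text \<open>At a descent inside a block, exchanging the two neighbouring values gives an element of the
  same coset with fewer inversions.\<close>

lemma min_coset_reps_increasing:
  assumes "\<pi> \<in> min_coset_reps r"
  shows "increasing_on_blocks r \<pi>"
  unfolding increasing_on_blocks_def
proof (intro allI impI)
  fix i j assume i: "i < length r" and j: "j \<in> young_block r i \<and> Suc j \<in> young_block r i"
  have p: "\<pi> permutes {1..sum_list r}" using assms by (simp add: min_coset_reps_def)
  show "\<pi> j < \<pi> (Suc j)"
  proof (rule ccontr)
    assume "\<not> \<pi> j < \<pi> (Suc j)"
    moreover have "\<pi> j \<noteq> \<pi> (Suc j)" using permutes_inj[OF p] by (metis injD n_not_Suc_n)
    ultimately have desc: "\<pi> (Suc j) < \<pi> j" by simp
    let ?s = "transpose j (Suc j)"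
    let ?n = "sum_list r"
    let ?I = "\<lambda>\<pi>. {(a, b). 1 \<le> a \<and> a < b \<and> b \<le> ?n \<and> \<pi> b < \<pi> a}"
    have jn: "1 \<le> j" "Suc j \<le> ?n" using j young_block_subset[of r i] by auto
    have "?s ` young_block r i' = young_block r i'" for i'
    proof -
      have "j \<in> young_block r i' \<longleftrightarrow> Suc j \<in> young_block r i'" using j young_block_unique by blast
      then show ?thesis by (intro transpose_image_eq) simp
    qed
    moreover have "?s permutes {1..?n}" using jn by (intro permutes_swap_id) auto
    ultimately have "?s \<in> young_subgroup r" by (simp add: young_subgroup_def)
    then have "\<pi> \<circ> ?s \<in> right_coset r \<pi>" by (auto simp: right_coset_def)
    then have "inversions ?n \<pi> \<le> inversions ?n (\<pi> \<circ> ?s)"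
      using assms by (simp add: min_coset_reps_def)
    moreover have fin: "finite (?I \<pi>)"
      by (rule finite_subset[of _ "{1..?n} \<times> {1..?n}"]) auto
    \<comment> \<open>exchanging \<open>j\<close> and \<open>Suc j\<close> in both places maps the inversions of the new permutation
      injectively to those of \<open>\<pi>\<close> and misses the descent\<close>
    have "inversions ?n (\<pi> \<circ> ?s) \<le> card (?I \<pi> - {(j, Suc j)})"
      unfolding inversions_def
    proof (rule card_inj_on_le[where f = "map_prod ?s ?s"])
      show "inj_on (map_prod ?s ?s) (?I (\<pi> \<circ> ?s))"
        by (rule inj_on_subset[OF prod.inj_map]) (auto simp: inj_swap)
      show "map_prod ?s ?s ` ?I (\<pi> \<circ> ?s) \<subseteq> ?I \<pi> - {(j, Suc j)}"
      proof (rule image_subsetI)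
        fix x assume "x \<in> ?I (\<pi> \<circ> ?s)"
        then obtain a b where x: "x = (a, b)"
          and ab: "1 \<le> a" "a < b" "b \<le> ?n" "(\<pi> \<circ> ?s) b < (\<pi> \<circ> ?s) a" by blast
        have "\<not> (a = j \<and> b = Suc j)" using ab(4) desc by auto
        then show "map_prod ?s ?s x \<in> ?I \<pi> - {(j, Suc j)}"
          using ab jn by (auto simp: x transpose_def split: if_splits)
      qed
    qed (use fin in simp)
    moreover have "card (?I \<pi> - {(j, Suc j)}) < card (?I \<pi>)"
      using desc jn fin by (intro card_Diff1_less) auto
    ultimately show False by (simp add: inversions_def)
  qed
qed

text \<open>This set composition determines the coset \<open>S\<^sub>r \<pi>\<close>.\<close>

definition block_images :: "nat list \<Rightarrow> (nat \<Rightarrow> nat) \<Rightarrow> nat set list" where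
  "block_images r \<pi> = map (\<lambda>i. \<pi> ` young_block r i) [0..<length r]"

text \<open>A permutation that increases on the blocks lists the image of each block in increasing
  order, and so does the rearrangement of \<open>1 2 \<dots> n\<close> by these images.\<close>

lemma increasing_perm_word:
  assumes p: "\<pi> permutes {1..sum_list r}" and inc: "increasing_on_blocks r \<pi>"
  shows "perm_word (sum_list r) \<pi> = reorder (block_images r \<pi>) [1..<Suc (sum_list r)]"
proof -
  let ?n = "sum_list r"
  let ?b = "\<lambda>i. [Suc (sum_list (take i r))..<Suc (sum_list (take (Suc i) r))]"
  have "map \<pi> (?b i) = filter (\<lambda>x. x \<in> \<pi> ` young_block r i) [1..<Suc ?n]" if "i < length r" for i
  proof (rule strict_sorted_equal)
    show "sorted_wrt (<) (map \<pi> (?b i))"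
    proof (subst sorted_wrt_iff_nth_Suc_transp)
      show "transp ((<) :: nat \<Rightarrow> _)" by simp
      show "\<forall>k. Suc k < length (map \<pi> (?b i)) \<longrightarrow> map \<pi> (?b i) ! k < map \<pi> (?b i) ! Suc k"
      proof (intro allI impI)
        fix k assume k: "Suc k < length (map \<pi> (?b i))"
        let ?j = "Suc (sum_list (take i r)) + k"
        have "?j \<in> young_block r i \<and> Suc ?j \<in> young_block r i"
          using k by (auto simp: young_block_def simp del: upt_Suc)
        then have "\<pi> ?j < \<pi> (Suc ?j)" using inc that by (simp only: increasing_on_blocks_def)
        then show "map \<pi> (?b i) ! k < map \<pi> (?b i) ! Suc k" using k by (simp del: upt_Suc)
      qed
    qed
    show "sorted_wrt (<) (filter (\<lambda>x. x \<in> \<pi> ` young_block r i) [1..<Suc ?n])"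
      by (intro sorted_wrt_filter) (simp del: upt_Suc)
    have "\<pi> ` young_block r i \<subseteq> {1..?n}"
      using young_block_subset[of r i] permutes_image[OF p] by blast
    moreover have "set [1..<Suc ?n] = {1..?n}" by auto
    ultimately show "set (map \<pi> (?b i)) = set (filter (\<lambda>x. x \<in> \<pi> ` young_block r i) [1..<Suc ?n])"
      by (auto simp: young_block_eq simp del: upt_Suc)
  qed
  then show ?thesis
    unfolding upt_eq_concat_blocks[of r] map_concat reorder_def block_images_def map_map o_def
    unfolding upt_eq_concat_blocks[of r, symmetric]
    by (intro arg_cong[where f = concat] map_cong refl) simp
qed

lemma block_images_set_composition:
  assumes p: "\<pi> permutes {1..sum_list r}" and r: "\<forall>s\<in>set r. 0 < s"
  shows "block_images r \<pi> \<in> set_compositions {1..sum_list r}" and "comp_type (block_images r \<pi>) = r"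
proof -
  have c: "card (young_block r i) = r ! i" if "i < length r" for i
    using that by (simp add: young_block_def take_Suc_conv_app_nth)
  have c': "card (\<pi> ` young_block r i) = r ! i" if "i < length r" for i
    using c[OF that] card_image[OF inj_on_subset[OF permutes_inj[OF p] subset_UNIV]] by simp
  show "comp_type (block_images r \<pi>) = r"
    by (rule nth_equalityI) (simp_all add: comp_type_def block_images_def c')
  have "{} \<notin> set (block_images r \<pi>)"
  proof
    assume "{} \<in> set (block_images r \<pi>)"
    then obtain i where "i < length r" "young_block r i = {}" by (auto simp: block_images_def)
    then show False using c[of i] r by (metis card.empty less_numeral_extra(3) nth_mem)
  qed
  moreover have "\<Union>(set (block_images r \<pi>)) = {1..sum_list r}"
  proof -
    have "(\<Union>i<length r. young_block r i) = set [1..<Suc (sum_list r)]"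
      by (simp only: upt_eq_concat_blocks set_concat set_map image_image set_upt young_block_eq atLeast0LessThan)
    then have "(\<Union>i<length r. young_block r i) = {1..sum_list r}" by auto
    moreover have "\<Union>(set (block_images r \<pi>)) = \<pi> ` (\<Union>i<length r. young_block r i)"
      by (simp add: block_images_def image_UN atLeast0LessThan)
    ultimately show ?thesis using permutes_image[OF p] by simp
  qed
  moreover have "sorted_wrt (\<lambda>B C. B \<inter> C = {}) (block_images r \<pi>)"
    unfolding sorted_wrt_iff_nth_less
  proof (intro allI impI)
    fix i j assume "i < j" "j < length (block_images r \<pi>)"
    moreover from this have "young_block r i \<inter> young_block r j = {}"
      using young_block_unique by (metis disjoint_iff less_irrefl)
    then have "\<pi> ` young_block r i \<inter> \<pi> ` young_block r j = {}"
      using permutes_inj[OF p] by (simp flip: image_Int)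
    ultimately show "block_images r \<pi> ! i \<inter> block_images r \<pi> ! j = {}"
      by (simp add: block_images_def)
  qed
  ultimately show "block_images r \<pi> \<in> set_compositions {1..sum_list r}"
    by (simp add: set_compositions_iff)
qed

text \<open>The lengths of the blocks being known, the concatenation in \<^const>\<open>reorder\<close> can be undone.\<close>

lemma block_images_of_reorder:
  assumes P: "P \<in> set_compositions {1..sum_list r}" "comp_type P = r"
    and w: "perm_word (sum_list r) \<pi> = reorder P [1..<Suc (sum_list r)]"
  shows "block_images r \<pi> = P"
proof -
  let ?b = "\<lambda>i. [Suc (sum_list (take i r))..<Suc (sum_list (take (Suc i) r))]"
  let ?f = "\<lambda>B. filter (\<lambda>x. x \<in> B) [1..<Suc (sum_list r)]"
  have l: "length P = length r" using P(2) by (auto simp: comp_type_def)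
  have S: "set (?f B) = B" if "B \<in> set P" for B
  proof -
    have "B \<subseteq> {1..sum_list r}" using P(1) that by (auto simp: set_compositions_iff)
    then show ?thesis by (auto simp del: upt_Suc)
  qed
  have len: "length (?f B) = card B" if "B \<in> set P" for B
  proof -
    have "card (set (?f B)) = length (?f B)" by (rule distinct_card) simp
    then show ?thesis by (simp only: S[OF that])
  qed
  have "concat (map (\<lambda>i. map \<pi> (?b i)) [0..<length r]) = concat (map ?f P)"
    using w unfolding reorder_def
    by (subst (asm) (1) upt_eq_concat_blocks) (simp add: map_concat o_def del: upt_Suc)
  then have eq: "map (\<lambda>i. map \<pi> (?b i)) [0..<length r] = map ?f P"
  proof (rule concat_eq_concat_iff[THEN iffD1, rotated -1])
    show "\<forall>(x, y)\<in>set (zip (map (\<lambda>i. map \<pi> (?b i)) [0..<length r]) (map ?f P)). length x = length y"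
    proof clarify
      fix x y assume "(x, y) \<in> set (zip (map (\<lambda>i. map \<pi> (?b i)) [0..<length r]) (map ?f P))"
      then obtain i where i: "i < length r" and x: "x = map \<pi> (?b i)" and y: "y = ?f (P ! i)"
        by (auto simp: set_zip l simp del: upt_Suc)
      have "length x = r ! i" using i by (simp add: x take_Suc_conv_app_nth del: upt_Suc)
      moreover have "card (P ! i) = r ! i" using P(2) l i by (metis comp_type_def nth_map)
      then have "length y = r ! i" unfolding y using len[of "P ! i"] i l by simp
      ultimately show "length x = length y" by simp
    qed
  qed (simp add: l)
  show ?thesis
  proof (rule nth_equalityI)
    show "length (block_images r \<pi>) = length P" by (simp add: block_images_def l)
    fix i assume "i < length (block_images r \<pi>)"
    then have i: "i < length r" by (simp add: block_images_def)
    have "map (\<lambda>i. map \<pi> (?b i)) [0..<length r] ! i = map ?f P ! i" by (simp only: eq)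
    then have "map \<pi> (?b i) = ?f (P ! i)" using i l by (simp del: upt_Suc)
    then have "\<pi> ` set (?b i) = set (?f (P ! i))" by (metis list.set_map)
    then show "block_images r \<pi> ! i = P ! i"
      using S[of "P ! i"] i l by (simp add: block_images_def young_block_eq del: upt_Suc)
  qed
qed

lemma right_coset_block_images:
  assumes "\<tau> \<in> right_coset r \<pi>"
  shows "block_images r \<tau> = block_images r \<pi>"
proof -
  obtain \<sigma> where s: "\<tau> = \<pi> \<circ> \<sigma>" "\<sigma> \<in> young_subgroup r" using assms by (auto simp: right_coset_def)
  then have "\<tau> ` young_block r i = \<pi> ` young_block r i" if "i < length r" for i
    using that by (simp only: image_comp[symmetric]) (simp add: young_subgroup_def)
  then show ?thesis by (simp add: block_images_def)
qed

lemma right_coset_trans: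
  assumes "\<tau> \<in> right_coset r \<pi>" "\<tau>' \<in> right_coset r \<tau>"
  shows "\<tau>' \<in> right_coset r \<pi>"
proof -
  obtain \<sigma> \<sigma>' where s: "\<tau> = \<pi> \<circ> \<sigma>" "\<tau>' = \<tau> \<circ> \<sigma>'" "\<sigma> \<in> young_subgroup r" "\<sigma>' \<in> young_subgroup r"
    using assms by (auto simp: right_coset_def)
  have "(\<sigma> \<circ> \<sigma>') ` young_block r i = young_block r i" if "i < length r" for i
    unfolding image_comp[symmetric] using s(3,4) that by (simp add: young_subgroup_def)
  then have "\<sigma> \<circ> \<sigma>' \<in> young_subgroup r"
    using s(3,4) by (auto simp: young_subgroup_def intro: permutes_compose)
  then show ?thesis
    unfolding right_coset_def s(1,2) by (intro image_eqI[of _ _ "\<sigma> \<circ> \<sigma>'"]) (simp_all add: o_assoc)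
qed

text \<open>Only one permutation in each coset is increasing on the blocks. Every coset has an element with the
  fewest inversions, which is increasing on the blocks and hence is this one.\<close>

lemma
  assumes r: "\<forall>s\<in>set r. 0 < s"
  shows bij_betw_min_coset_reps: "bij_betw (block_images r) (min_coset_reps r)
      {P \<in> set_compositions {1..sum_list r}. comp_type P = r}"
    and perm_word_min_coset_rep: "\<pi> \<in> min_coset_reps r \<Longrightarrow>
      perm_word (sum_list r) \<pi> = reorder (block_images r \<pi>) [1..<Suc (sum_list r)]"
proof -
  let ?n = "sum_list r"
  have p: "\<pi> permutes {1..?n}" if "\<pi> \<in> min_coset_reps r" for \<pi>
    using that by (simp add: min_coset_reps_def)
  show w: "perm_word ?n \<pi> = reorder (block_images r \<pi>) [1..<Suc ?n]" if "\<pi> \<in> min_coset_reps r" for \<pi>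
    using increasing_perm_word[OF p[OF that] min_coset_reps_increasing[OF that]] .
  show "bij_betw (block_images r) (min_coset_reps r) {P \<in> set_compositions {1..?n}. comp_type P = r}"
    unfolding bij_betw_def
  proof
    show "inj_on (block_images r) (min_coset_reps r)"
    proof (rule inj_onI)
      fix \<pi> \<pi>' assume "\<pi> \<in> min_coset_reps r" "\<pi>' \<in> min_coset_reps r" "block_images r \<pi> = block_images r \<pi>'"
      then show "\<pi> = \<pi>'"
        using w p bij_betw_imp_inj_on[OF bij_betw_perm_word[of ?n]] by (metis inj_onD mem_Collect_eq)
    qed
    show "block_images r ` min_coset_reps r = {P \<in> set_compositions {1..?n}. comp_type P = r}"
    proof (intro equalityI subsetI)
      \<comment> \<open>some permutation has the block images \<open>P\<close>, and so has a minimal one in its coset\<close>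
    fix P assume P: "P \<in> {P \<in> set_compositions {1..?n}. comp_type P = r}"
      then have "reorder P [1..<Suc ?n] \<in> orderings ?n"
        by (intro reorder_in_orderings upt_in_orderings) auto
      then obtain \<pi> where \<pi>: "\<pi> permutes {1..?n}" "perm_word ?n \<pi> = reorder P [1..<Suc ?n]"
        using bij_betw_imp_surj_on[OF bij_betw_perm_word[of ?n]] by (metis (no_types, lifting) imageE mem_Collect_eq)
      have "id \<in> young_subgroup r" by (simp add: young_subgroup_def permutes_id)
      then have "\<pi> \<in> right_coset r \<pi>" 
        unfolding right_coset_def by (intro image_eqI[of _ _ id]) simp_all
      then obtain \<tau> where \<tau>: "\<tau> \<in> right_coset r \<pi>"
        "\<forall>\<tau>'. \<tau>' \<in> right_coset r \<pi> \<longrightarrow> inversions ?n \<tau> \<le> inversions ?n \<tau>'"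
        using ex_has_least_nat[of "\<lambda>\<tau>. \<tau> \<in> right_coset r \<pi>" \<pi> "inversions ?n"] by blast
      have "\<tau> permutes {1..?n}"
        using \<tau>(1) \<pi>(1) by (auto simp: right_coset_def young_subgroup_def permutes_compose)
      then have "\<tau> \<in> min_coset_reps r"
        using \<tau> right_coset_trans[OF \<tau>(1)] by (simp add: min_coset_reps_def)
      moreover have "block_images r \<tau> = P"
        using right_coset_block_images[OF \<tau>(1)] block_images_of_reorder[OF _ _ \<pi>(2)] P by simp
      ultimately show "P \<in> block_images r ` min_coset_reps r" by blast
    qed (use p block_images_set_composition[OF _ r] in auto)
  qed
qed


section \<open>The action of the Solomon algebra\<close>

lemma lin_polya [simp, intro]: "lin (polya a)"
  and lin_polya_left [simp, intro]: "lin (\<lambda>a. polya a u)"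
  by (simp_all add: polya_def)

lemma polya_single [simp]:
  "polya (Poly_Mapping.single \<pi> c) (Poly_Mapping.single w d) = Poly_Mapping.single (polya_word \<pi> w) (c * d)"
  by (simp add: polya_def)

lemma list_product_gen:
  "list_product (\<lambda>i. gen (f i)) xs = Poly_Mapping.single (Word (map f xs)) 1"
  by (induction xs)
    (simp_all add: gen_def mult_single plus_free_monoid_def flip: single_one zero_free_monoid_def)

lemma map_nth_upt: "map (\<lambda>i. xs ! (i - 1)) [1..<Suc (length xs)] = xs"
  by (rule nth_equalityI) (simp_all del: upt_Suc)

text \<open>On a word, both sides are the sum of its rearrangements by the set compositions of type \<open>r\<close>: the
  left one because these correspond to the minimal coset representatives, the right one because a
  word is a product of primitive elements of degree 1.\<close>

lemma polya_\<Xi>_eq_conv_proj: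
  fixes u :: "('x, 'f::field) free_algebra"
  assumes r: "r \<in> compositions n" and u: "u \<in> homogeneous n"
  shows "polya (\<Xi> r) u = conv_proj r u"
proof (rule lin_eqI[where u = u])
  fix w assume w: "w \<in> Poly_Mapping.keys u"
  let ?ws = "letters w"
  let ?G = "\<lambda>xs. list_product (\<lambda>i. gen (?ws ! (i - 1)) :: ('x, 'f) free_algebra) xs"
  let ?P = "{P \<in> set_compositions {1..n}. comp_type P = r}"
  let ?w = "Poly_Mapping.single w (1 :: 'f)"
  have l: "length ?ws = n" using u w by (simp add: homogeneous_def)
  have n: "sum_list r = n" and pos: "\<forall>s\<in>set r. 0 < s" using r by (auto simp: compositions_def)
  have S: "set [1..<Suc n] = {1..n}" by auto
  have "polya (\<Xi> r) (?w) =
      (\<Sum>\<pi>\<in>min_coset_reps r. Poly_Mapping.single (polya_word \<pi> w) 1)"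
    unfolding \<Xi>_def lin_sum[OF lin_polya_left] by simp
  also have "\<dots> = (\<Sum>\<pi>\<in>min_coset_reps r. ?G (reorder (block_images r \<pi>) [1..<Suc n]))"
  proof (rule sum.cong[OF refl])
    fix \<pi> assume "\<pi> \<in> min_coset_reps r"
    then have "reorder (block_images r \<pi>) [1..<Suc n] = perm_word n \<pi>"
      using perm_word_min_coset_rep[OF pos, of \<pi>] by (simp only: n)
    then show "Poly_Mapping.single (polya_word \<pi> w) (1 :: 'f) = ?G (reorder (block_images r \<pi>) [1..<Suc n])"
      by (simp only: list_product_gen polya_word_def l map_map o_def)
  qed
  also have "\<dots> = (\<Sum>P\<in>?P. ?G (reorder P [1..<Suc n]))"
    using sum.reindex_bij_betw[OF bij_betw_min_coset_reps[OF pos], of "\<lambda>P. ?G (reorder P [1..<Suc n])"]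
    by (simp only: n)
  also have "\<dots> = conv_proj r (?G [1..<Suc n])"
  proof -
    have "conv_proj r (?G [1..<Suc n]) =
      (\<Sum>T\<in>{T \<in> set_compositions (set [1..<Suc n]). map (\<lambda>B. \<Sum>i\<in>B. 1) T = r}. ?G (reorder T [1..<Suc n]))"
      by (rule conv_proj_product_of_primitives) (use pos in \<open>simp_all add: primitive_gen homogeneous_gen[simplified] del: upt_Suc\<close>)
    moreover have "card = (\<lambda>B :: nat set. \<Sum>i\<in>B. 1)" by (simp add: fun_eq_iff)
    ultimately show ?thesis by (simp only: S comp_type_def)
  qed
  also have "?G [1..<Suc n] = ?w"
    using map_nth_upt[of ?ws] by (simp only: list_product_gen l free_monoid.collapse)
  finally show "polya (\<Xi> r) (?w) = conv_proj r (?w)" .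
qed simp_all

lemma lookup_perm_act:
  assumes "inj \<pi>"
  shows "Poly_Mapping.lookup (perm_act \<pi> f) (map ((`) \<pi>) P) = Poly_Mapping.lookup f P"
proof -
  have inj: "map ((`) \<pi>) R = map ((`) \<pi>) P \<longleftrightarrow> R = P" for R
    using inj_map_eq_map[of "(`) \<pi>" R P] inj_image_eq_iff[OF assms] by (simp add: inj_def)
  have "Poly_Mapping.lookup (perm_act \<pi> f) (map ((`) \<pi>) P) =
      (\<Sum>R\<in>Poly_Mapping.keys f. if R = P then Poly_Mapping.lookup f R else 0)"
    unfolding perm_act_def linear_ext_def lookup_sum
    by (rule sum.cong) (simp_all add: lookup_single when_def inj)
  then show ?thesis by (auto simp: in_keys_iff)
qed

text \<open>Both set compositions are the images of the same standard blocks.\<close>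

lemma ex_permutation_of_set_compositions:
  assumes P: "P \<in> set_compositions {1..n}" and R: "R \<in> set_compositions {1..n}"
    and "comp_type P = comp_type R"
  shows "\<exists>\<pi>. \<pi> permutes {1..n} \<and> map ((`) \<pi>) P = R"
proof -
  let ?r = "comp_type P"
  have pos: "\<forall>s\<in>set ?r. 0 < s" and n: "sum_list ?r = n"
    using comp_type_in_compositions[OF P] by (auto simp: compositions_def)
  have "P \<in> block_images ?r ` min_coset_reps ?r" "R \<in> block_images ?r ` min_coset_reps ?r"
    using bij_betw_imp_surj_on[OF bij_betw_min_coset_reps[OF pos]] P R assms(3) n by auto
  then obtain \<pi> \<rho> where \<pi>: "\<pi> \<in> min_coset_reps ?r" "P = block_images ?r \<pi>"
    and \<rho>: "\<rho> \<in> min_coset_reps ?r" "R = block_images ?r \<rho>" by blast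
  have p: "\<pi> permutes {1..n}" "\<rho> permutes {1..n}"
    using \<pi>(1) \<rho>(1) n by (auto simp: min_coset_reps_def)
  have "(\<rho> \<circ> inv \<pi>) ` \<pi> ` B = \<rho> ` B" for B
    by (simp only: image_comp[symmetric] image_inv_f_f[OF permutes_inj[OF p(1)]])
  then have "map ((`) (\<rho> \<circ> inv \<pi>)) (block_images ?r \<pi>) = block_images ?r \<rho>"
    by (simp add: block_images_def)
  then show ?thesis
    using \<pi>(2) \<rho>(2) permutes_compose[OF permutes_inv[OF p(1)] p(2)] by metis
qed

text \<open>An invariant has equal coefficients at set compositions of equal type, since these form one
  orbit of the symmetric group.\<close>

lemma \<B>_eq_combination:
  assumes b: "b \<in> \<B> n"
  obtains c where "b = (\<Sum>r\<in>compositions n. pscale (c r) (X_elt r) :: _ \<Rightarrow>\<^sub>0 'f::field)"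
proof -
  obtain P where P: "\<And>r. r \<in> compositions n \<Longrightarrow>
      P r \<in> set_compositions {1..sum_list r} \<and> comp_type (P r) = r"
    using ex_set_composition_of_type unfolding compositions_def by (metis (mono_tags, lifting) mem_Collect_eq)
  note type = comp_type_in_compositions
  let ?c = "\<lambda>r. Poly_Mapping.lookup b (P r)"
  have "b = (\<Sum>r\<in>compositions n. pscale (?c r) (X_elt r))"
  proof (rule poly_mapping_eqI)
    fix R
    have "Poly_Mapping.lookup (\<Sum>r\<in>compositions n. pscale (?c r) (X_elt r)) R =
        (\<Sum>r\<in>compositions n. if r = comp_type R then (if R \<in> set_compositions {1..n} then ?c r else 0) else 0)"
      unfolding lookup_sum by (rule sum.cong) (auto simp: lookup_X_elt compositions_def)
    also have "\<dots> = (if R \<in> set_compositions {1..n} then ?c (comp_type R) else 0)"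
      using type by (auto simp: finite_compositions)
    also have "\<dots> = Poly_Mapping.lookup b R"
    proof (cases "R \<in> set_compositions {1..n}")
      case True
      let ?P = "P (comp_type R)"
      have "?P \<in> set_compositions {1..n}" "comp_type ?P = comp_type R"
        using P[OF type[OF True]] type[OF True] by (auto simp: compositions_def)
      then obtain \<pi> where \<pi>: "\<pi> permutes {1..n}" "map ((`) \<pi>) ?P = R"
        using ex_permutation_of_set_compositions[OF _ True] by blast
      have "Poly_Mapping.lookup b R = Poly_Mapping.lookup (perm_act \<pi> b) (map ((`) \<pi>) ?P)"
        using b \<pi> by (simp add: \<B>_def)
      then show ?thesis using True lookup_perm_act[OF permutes_inj[OF \<pi>(1)], of b ?P] by (simp only: if_True)
    next
      case False
      then show ?thesis using b by (auto simp: \<B>_def F\<Pi>_def in_keys_iff subset_iff)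
    qed
    finally show "Poly_Mapping.lookup b R = Poly_Mapping.lookup (\<Sum>r\<in>compositions n. pscale (?c r) (X_elt r)) R" ..
  qed
  then show thesis by (rule that)
qed

lemma bidigare_combination:
  "bidigare n (\<Sum>r\<in>compositions n. pscale (c r) (X_elt r)) =
     (\<Sum>r\<in>compositions n. pscale (c r) (\<Xi> r) :: _ \<Rightarrow>\<^sub>0 'f::field)"
proof -
  let ?X = "X_elt ` compositions n :: (nat set list \<Rightarrow>\<^sub>0 'f) set"
  have sp: "(X_elt s :: _ \<Rightarrow>\<^sub>0 'f) \<in> pm.span ?X" if "s \<in> compositions n" for s
    using that by (intro pm.span_base imageI)
  have "pm.representation ?X (\<Sum>s\<in>compositions n. pscale (c s) (X_elt s)) (X_elt r) = c r"
    if r: "r \<in> compositions n" for r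
  proof -
    have "pm.representation ?X (\<Sum>s\<in>compositions n. pscale (c s) (X_elt s)) (X_elt r) =
        (\<Sum>s\<in>compositions n. c s * pm.representation ?X (X_elt s) (X_elt r))"
      by (subst pm.representation_sum[OF independent_X_elt])
        (auto simp: pm.representation_scale[OF independent_X_elt] sp intro: pm.span_scale)
    also have "\<dots> = (\<Sum>s\<in>compositions n. if s = r then c s else 0)"
    proof (rule sum.cong[OF refl])
      fix s assume s: "s \<in> compositions n"
      have "(X_elt r :: _ \<Rightarrow>\<^sub>0 'f) = X_elt s \<longleftrightarrow> s = r"
        using inj_on_eq_iff[OF inj_on_X_elt r s] by auto
      then show "c s * pm.representation ?X (X_elt s) (X_elt r) = (if s = r then c s else 0)"
        by (simp only: pm.representation_basis[OF independent_X_elt imageI[OF s]]) simp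
    qed
    finally show ?thesis using r by (simp add: finite_compositions)
  qed
  then show ?thesis unfolding bidigare_def by (intro sum.cong refl) simp
qed


section \<open>Comparison of the two modules\<close>

text \<open>An injective linear map that intertwines the actions reflects every module axiom. In particular,
  associativity of \<open>act\<close> is inherited from that of \<open>act'\<close>.\<close>

lemma \<B>_module_isomorphicI:
  fixes act' :: "(nat set list \<Rightarrow>\<^sub>0 'f::field) \<Rightarrow> ('b \<Rightarrow>\<^sub>0 'f) \<Rightarrow> ('b \<Rightarrow>\<^sub>0 'f)"
    and \<phi> :: "('a \<Rightarrow>\<^sub>0 'f) \<Rightarrow> ('b \<Rightarrow>\<^sub>0 'f)"
  assumes N: "\<B>_module n act' N" and M: "pm.subspace M"
    and closed: "\<And>b u. b \<in> \<B> n \<Longrightarrow> u \<in> M \<Longrightarrow> act b u \<in> M"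
    and \<phi>: "lin \<phi>" "bij_betw \<phi> M N"
    and eq: "\<And>b u. b \<in> \<B> n \<Longrightarrow> u \<in> M \<Longrightarrow> \<phi> (act b u) = act' b (\<phi> u)"
  shows "\<B>_module_isomorphic n act M act' N"
proof -
  interpret N: \<B>_module n act' N by (rule N)
  have \<phi>N: "\<phi> u \<in> N" if "u \<in> M" for u using \<phi>(2) that by (auto simp: bij_betw_def)
  have inj: "u = v" if "\<phi> u = \<phi> v" "u \<in> M" "v \<in> M" for u v
    using \<phi>(2) that by (auto simp: bij_betw_def inj_on_def)
  note clos = closed pm.subspace_add[OF M] pm.subspace_scale[OF M] pm.subspace_add[OF subspace_\<B>]
    pm.subspace_scale[OF subspace_\<B>] wedge_in_\<B> \<B>_one_in_\<B>
  note lins = lin_add[OF \<phi>(1)] lin_scale[OF \<phi>(1)]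
  have "\<B>_module n act M"
  proof
    fix b c :: "nat set list \<Rightarrow>\<^sub>0 'f" and u v x
    show "act (b + c) u = act b u + act c u" if "b \<in> \<B> n" "c \<in> \<B> n" "u \<in> M"
      by (rule inj) (use that in \<open>simp_all add: clos lins eq \<phi>N N.act_add_left\<close>)
    show "act b (u + v) = act b u + act b v" if "b \<in> \<B> n" "u \<in> M" "v \<in> M"
      by (rule inj) (use that in \<open>simp_all add: clos lins eq \<phi>N N.act_add_right\<close>)
    show "act (pscale x b) u = pscale x (act b u)" if "b \<in> \<B> n" "u \<in> M"
      by (rule inj) (use that in \<open>simp_all add: clos lins eq \<phi>N N.act_scale_left\<close>)
    show "act b (pscale x u) = pscale x (act b u)" if "b \<in> \<B> n" "u \<in> M"
      by (rule inj) (use that in \<open>simp_all add: clos lins eq \<phi>N N.act_scale_right\<close>)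
    show "act (wedge b c) u = act b (act c u)" if "b \<in> \<B> n" "c \<in> \<B> n" "u \<in> M"
      by (rule inj) (use that in \<open>simp_all add: clos lins eq \<phi>N N.act_mult\<close>)
    show "act (\<B>_one n) u = u" if "u \<in> M"
      by (rule inj) (use that in \<open>simp_all add: clos lins eq \<phi>N N.act_one\<close>)
  qed (use M closed in auto)
  then show ?thesis
    unfolding \<B>_module_isomorphic_def using N \<phi> eq
    by (intro conjI exI[of _ \<phi>]) (auto simp: lins)
qed

lemma subspace_\<Lambda>: "pm.subspace (\<Lambda> n Q)"
  unfolding \<Lambda>_def by (rule pmp.linear_subspace_image[OF lin_wedge_left subspace_F\<Pi>])

text \<open>A left ideal is a module because \<open>\<and>\<close> is associative.\<close>

lemma \<B>_module_\<Lambda>: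
  assumes "e_comp Q \<in> (F\<Pi> {1..n} :: (_ \<Rightarrow>\<^sub>0 'f::field) set)"
  shows "\<B>_module n wedge (\<Lambda> n Q :: (_ \<Rightarrow>\<^sub>0 'f) set)"
proof
  fix b u :: "nat set list \<Rightarrow>\<^sub>0 'f"
  assume b: "b \<in> \<B> n" and u: "u \<in> \<Lambda> n Q"
  obtain f where f: "f \<in> F\<Pi> {1..n}" "u = wedge f (e_comp Q)" using u by (auto simp: \<Lambda>_def)
  have "wedge b f \<in> F\<Pi> {1..n}" using b f(1) by (auto simp: \<B>_def intro: wedge_in_F\<Pi>)
  then show "wedge b u \<in> \<Lambda> n Q" unfolding f(2) \<Lambda>_def wedge_assoc[symmetric] by (rule imageI)
next
  fix u :: "nat set list \<Rightarrow>\<^sub>0 'f"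
  assume "u \<in> \<Lambda> n Q"
  then have "u \<in> F\<Pi> {1..n}" using assms by (auto simp: \<Lambda>_def intro: wedge_in_F\<Pi>)
  then show "wedge (\<B>_one n) u = u" by (rule \<B>_one_wedge)
qed (simp_all add: subspace_\<Lambda> wedge_assoc lin_add[OF lin_wedge_left] lin_add[OF lin_wedge_right]
    lin_scale[OF lin_wedge_left] lin_scale[OF lin_wedge_right])

theorem theorem9p7:
  fixes n :: nat and q :: "nat list"
    and l :: "('x, 'f::field_char_0) free_algebra list"
    and Q :: "nat set list"
  assumes "infinite (UNIV :: 'x set)"
    and "q \<in> compositions n"
    and "\<forall>a\<in>set l. a \<in> lie_monomials"
    and "generic l"
    and "has_lie_type l q"
    and "Q \<in> set_compositions {1..n}"
    and "comp_type Q = q"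
  shows "\<B>_module_isomorphic n (U_act n) (U_span l) wedge (\<Lambda> n Q)"
proof -
  define k where "k = length q"
  let ?q = "\<lambda>i. q ! (i - 1)"
  let ?l = "\<lambda>i. l ! (i - 1)"
  let ?Q = "\<lambda>i. Q ! (i - 1)"
  let ?h = "\<lambda>xs. list_product ?l xs"
  let ?g = "\<lambda>xs. e_comp (map ?Q xs) :: nat set list \<Rightarrow>\<^sub>0 'f"
  let ?S = "orderings k"
  let ?T = "\<lambda>r. {T \<in> set_compositions {1..k}. map (\<lambda>B. \<Sum>i\<in>B. ?q i) T = r}"
  have len: "length l = k" "length Q = k"
    using assms(5,7) by (auto simp: k_def has_lie_type_def comp_type_def dest: list_all2_lengthD)
  have S: "distinct xs" "set xs = {1..k}" if "xs \<in> ?S" for xs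
    using that by (simp_all add: orderings_def)
  have idx: "i - 1 < k" if "i \<in> {1..k}" for i using that by auto
  have l: "primitive (?l i)" "?l i \<in> homogeneous (?q i)" "0 < ?q i" if "i \<in> {1..k}" for i
  proof -
    have i: "i - 1 < length q" using idx[OF that] by (simp add: k_def)
    show "primitive (?l i)" using assms(3) i len by (intro primitive_lie_monomial) (simp add: k_def)
    show "?l i \<in> homogeneous (?q i)"
      using list_all2_nthD2[OF assms(5)[unfolded has_lie_type_def] i] by (simp add: lie_homogeneous_def)
    show "0 < ?q i" using assms(2) i by (simp add: compositions_def)
  qed
  have xs0: "[1..<Suc k] \<in> ?S" by (rule upt_in_orderings)
  have setQ: "?Q ` {1..k} = set Q"
  proof -
    have "set (map ?Q [1..<Suc (length Q)]) = set Q" by (simp only: map_nth_upt)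
    then show ?thesis by (simp only: set_map len S(2)[OF xs0])
  qed
  then have QU: "\<Union>(?Q ` {1..k}) = {1..n}"
    using assms(6) by (simp only: set_compositions_iff)
  have Qne: "\<forall>i\<in>{1..k}. ?Q i \<noteq> {}"
  proof
    fix i assume "i \<in> {1..k}"
    then have "?Q i \<in> set Q" unfolding setQ[symmetric] by (rule imageI)
    then show "?Q i \<noteq> {}" using assms(6) unfolding set_compositions_iff by metis
  qed
  have Qfin: "\<forall>i\<in>{1..k}. finite (?Q i)"
  proof
    fix i assume "i \<in> {1..k}"
    then have "?Q i \<subseteq> {1..n}" unfolding QU[symmetric] by (rule UN_upper)
    then show "finite (?Q i)" by (rule finite_subset) simp
  qed
  have Qdisj: "disjoint_family_on ?Q {1..k}"
    unfolding disjoint_family_on_def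
  proof (intro ballI impI)
    fix i j assume ij: "i \<in> {1..k}" "j \<in> {1..k}" "i \<noteq> j"
    then have "i - 1 \<noteq> j - 1" by auto
    then show "?Q i \<inter> ?Q j = {}"
      using assms(6) idx[OF ij(1)] idx[OF ij(2)] unfolding set_compositions_def len(2)[symmetric] by blast
  qed
  have Qcard: "card (?Q i) = ?q i" if "i \<in> {1..k}" for i
    using assms(7) idx[OF that] len by (auto simp: comp_type_def)
  have Q0: "e_comp Q = ?g [1..<Suc k]"
    using map_nth_upt[of Q] by (simp only: len)
  have hom: "?h xs \<in> homogeneous n" if "xs \<in> ?S" for xs
  proof -
    have "?h xs \<in> homogeneous (\<Sum>i\<leftarrow>xs. ?q i)"
      using S[OF that] l by (intro homogeneous_list_product) simp
    also have "(\<Sum>i\<leftarrow>xs. ?q i) = (\<Sum>i\<leftarrow>[1..<Suc k]. ?q i)"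
      using S[OF that] S[OF xs0] by (simp only: sum_list_distinct_conv_sum_set)
    also have "\<dots> = n"
      using map_nth_upt[of q] assms(2) by (simp only: k_def compositions_def mem_Collect_eq)
    finally show ?thesis .
  qed
  \<comment> \<open>the common formula for the action on the two bases\<close>
  have act_h: "polya (\<Xi> r) (?h xs) = (\<Sum>T\<in>?T r. ?h (reorder T xs))"
    if r: "r \<in> compositions n" and xs: "xs \<in> ?S" for r xs
  proof -
    have "polya (\<Xi> r) (?h xs) = conv_proj r (?h xs)"
      by (rule polya_\<Xi>_eq_conv_proj[OF r hom[OF xs]])
    also have "\<dots> = (\<Sum>T\<in>?T r. ?h (reorder T xs))"
      using conv_proj_product_of_primitives[of xs ?l ?q r] S[OF xs] l r by (simp add: compositions_def)
    finally show ?thesis .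
  qed
  have act_g: "wedge (X_elt r) (?g xs) = (\<Sum>T\<in>?T r. ?g (reorder T xs))"
    if r: "r \<in> compositions n" and xs: "xs \<in> ?S" for r xs
  proof -
    have n: "sum_list r = n" using r by (simp add: compositions_def)
    have "(\<Sum>i\<in>B. card (?Q i)) = (\<Sum>i\<in>B. ?q i)" if "T \<in> set_compositions {1..k}" "B \<in> set T" for T B
    proof -
      have "B \<subseteq> {1..k}" using that by (auto simp: set_compositions_iff)
      then show ?thesis by (intro sum.cong refl Qcard) blast
    qed
    then have T: "{T \<in> set_compositions {1..k}. map (\<lambda>B. \<Sum>i\<in>B. card (?Q i)) T = r} = ?T r"
      by (auto cong: map_cong)
    show ?thesis
      by (rule X_elt_wedge_e_comp[of xs ?Q r, unfolded S(2)[OF xs] n T,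
            OF S(1)[OF xs] Qfin Qdisj Qne QU])
  qed
  have inj_h: "inj_on ?h ?S" and ind_h: "pm.independent (?h ` ?S)" and U: "U_span l = pm.span (?h ` ?S)"
  proof -
    have W: "perm_word k ` {\<pi>. \<pi> permutes {1..k}} = ?S"
      using bij_betw_imp_surj_on[OF bij_betw_perm_word] .
    have pp: "perm_prod l = ?h \<circ> perm_word k"
      by (rule ext) (simp add: perm_prod_def len o_def del: upt_Suc)
    have gen: "inj_on (perm_prod l) {\<pi>. \<pi> permutes {1..k}}"
      "pm.independent (perm_prod l ` {\<pi>. \<pi> permutes {1..k}})"
      using assms(4) unfolding generic_def len by blast+
    have im: "?h ` ?S = perm_prod l ` {\<pi>. \<pi> permutes {1..k}}"
      unfolding pp W[symmetric] image_comp ..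
    show "pm.independent (?h ` ?S)" unfolding im by (rule gen(2))
    show "U_span l = pm.span (?h ` ?S)" unfolding im U_span_def len ..
    show "inj_on ?h ?S"
      using gen(1) unfolding pp W[symmetric] by (rule inj_on_imageI)
  qed
  have lookup_g: "Poly_Mapping.lookup (?g xs) (map ?Q ys) = (if xs = ys then 1 else 0)"
    if "xs \<in> ?S" "ys \<in> ?S" for xs ys
    using lookup_e_comp[of xs ?Q ys] S[OF that(1)] S[OF that(2)] Qfin Qdisj Qne by simp
  have inj_g: "inj_on ?g ?S" and ind_g: "pm.independent (?g ` ?S)"
    using independent_family_by_lookup[OF finite_orderings, of k ?g "map ?Q"] lookup_g by blast+
  have g_F\<Pi>: "?g xs \<in> F\<Pi> {1..n}" if "xs \<in> ?S" for xs
    by (rule e_comp_in_F\<Pi>[of xs ?Q, unfolded S(2)[OF that] QU, OF S(1)[OF that] Qfin Qdisj])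
  have \<Lambda>: "\<Lambda> n Q = pm.span (?g ` ?S)"
  proof
    let ?xs = "[1..<Suc k]"
    let ?u = "map (\<lambda>B. \<Union>(?Q ` B))"
    note e0 = wedge_e_comp_eq_0[of ?xs ?Q, unfolded S(2)[OF xs0], OF S(1)[OF xs0] Qfin Qdisj]
    note e1 = wedge_e_comp_eq_reorder[of ?xs ?Q, unfolded S(2)[OF xs0], OF S(1)[OF xs0] Qfin Qdisj]
    note img = image_merge_blocks[OF Qfin Qdisj Qne, unfolded QU]
    show "\<Lambda> n Q \<subseteq> pm.span (?g ` ?S)"
      unfolding \<Lambda>_def
    proof (rule image_subsetI)
      fix f :: "nat set list \<Rightarrow>\<^sub>0 'f" assume f: "f \<in> F\<Pi> {1..n}"
      show "wedge f (e_comp Q) \<in> pm.span (?g ` ?S)"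
      proof (rule lin_image_in_subspace[OF lin_wedge_left pm.subspace_span])
        fix P assume "P \<in> Poly_Mapping.keys f"
        then have P: "P \<in> set_compositions {1..n}" using f by (auto simp: F\<Pi>_def)
        show "wedge (Poly_Mapping.single P 1) (e_comp Q) \<in> pm.span (?g ` ?S)"
        proof (cases "\<forall>i\<in>{1..k}. \<exists>B\<in>set P. ?Q i \<subseteq> B")
          case True
          then have "P \<in> ?u ` set_compositions {1..k}" using P unfolding img by simp
          then obtain T where T: "T \<in> set_compositions {1..k}" "P = ?u T" by (rule imageE) 
          show ?thesis
            unfolding Q0 T(2) e1[OF T(1)]
            by (intro pm.span_base imageI reorder_in_orderings T(1) xs0)
        next
          case False
          then obtain i where i: "i \<in> {1..k}" "\<forall>B\<in>set P. \<not> ?Q i \<subseteq> B" by blast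
          have "?Q i \<subseteq> {1..n}" unfolding QU[symmetric] using i(1) by (rule UN_upper)
          then show ?thesis
            unfolding Q0 e0[OF P i(1) Qne[rule_format, OF i(1)] \<open>?Q i \<subseteq> {1..n}\<close> i(2)]
            by (intro pm.span_zero)
        qed
      qed
    qed
    \<comment> \<open>\<open>e\<^sub>\<sigma> = P \<and> e\<^sub>Q\<close> for the rearrangement \<open>P\<close> of \<open>Q\<close> given by \<open>\<sigma>\<close>\<close>
    show "pm.span (?g ` ?S) \<subseteq> \<Lambda> n Q"
    proof (rule pm.span_minimal[OF image_subsetI subspace_\<Lambda>])
      fix xs assume xs: "xs \<in> ?S"
      let ?T = "map (\<lambda>i. {i}) xs"
      have T: "?T \<in> set_compositions {1..k}"
        using singletons_in_set_compositions[OF S(1)[OF xs]] S(2)[OF xs] by simp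
      have r: "reorder ?T ?xs = xs"
        by (rule reorder_singletons) (simp_all only: S[OF xs] S[OF xs0])
      have "?u ?T \<in> set_compositions {1..n}"
        using imageI[OF T, of ?u] unfolding img by simp
      then show "?g xs \<in> \<Lambda> n Q"
        unfolding \<Lambda>_def Q0
        by (intro image_eqI[where x = "Poly_Mapping.single (?u ?T) 1"] single_in_F\<Pi>)
          (simp_all only: e1[OF T] r)
    qed
  qed
  obtain \<phi> where \<phi>: "lin \<phi>" and \<phi>h: "\<And>xs. xs \<in> ?S \<Longrightarrow> \<phi> (?h xs) = ?g xs"
  proof -
    obtain \<phi> where \<phi>: "lin \<phi>" "\<forall>u\<in>?h ` ?S. \<phi> u = ?g (inv_into ?S ?h u)"
      using pmp.linear_independent_extend[OF ind_h, of "\<lambda>u. ?g (inv_into ?S ?h u)"] by (elim exE conjE)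
    have "\<phi> (?h xs) = ?g xs" if xs: "xs \<in> ?S" for xs
      using bspec[OF \<phi>(2) imageI[OF xs]] by (simp only: inv_into_f_f[OF inj_h xs])
    with \<phi>(1) show thesis by (rule that)
  qed
  have \<phi>img: "\<phi> ` (?h ` ?S) = ?g ` ?S" using \<phi>h by (force simp: image_image)
  have U_act_eq: "U_act n b u = (\<Sum>r\<in>compositions n. pscale (c r) (polya (\<Xi> r) u))"
    if "b = (\<Sum>r\<in>compositions n. pscale (c r) (X_elt r))" for b c u
    unfolding U_act_def that bidigare_combination
    by (simp add: lin_sum[OF lin_polya_left] lin_scale[OF lin_polya_left])
  have lin_U_act: "lin (U_act n b)" for b :: "nat set list \<Rightarrow>\<^sub>0 'f"
    unfolding U_act_def by simp
  have U_act_h: "U_act n b (?h xs) = (\<Sum>r\<in>compositions n. pscale (c r) (\<Sum>T\<in>?T r. ?h (reorder T xs)))"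
    if "b = (\<Sum>r\<in>compositions n. pscale (c r) (X_elt r))" "xs \<in> ?S" for b c xs
    unfolding U_act_eq[OF that(1)] by (rule sum.cong) (simp_all only: act_h that(2))
  have wedge_g: "wedge b (?g xs) = (\<Sum>r\<in>compositions n. pscale (c r) (\<Sum>T\<in>?T r. ?g (reorder T xs)))"
    if "b = (\<Sum>r\<in>compositions n. pscale (c r) (X_elt r))" "xs \<in> ?S" for b c xs
    unfolding that(1) lin_sum[OF lin_wedge_left] lin_scale[OF lin_wedge_left]
    by (rule sum.cong) (simp_all only: act_g that(2))
  have T_S: "reorder T xs \<in> ?S" if "T \<in> ?T r" "xs \<in> ?S" for T r xs
    using that by (intro reorder_in_orderings) simp_all
  show ?thesis
    unfolding U \<Lambda>
  proof (rule \<B>_module_isomorphicI)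
    show "\<B>_module n wedge (pm.span (?g ` ?S))"
      unfolding \<Lambda>[symmetric] using g_F\<Pi>[OF xs0] by (intro \<B>_module_\<Lambda>) (simp only: Q0)
    have "inj_on \<phi> (?h ` ?S)"
      by (rule inj_onI) (use inj_g \<phi>h in \<open>auto dest: inj_onD\<close>)
    then have "inj_on \<phi> (pm.span (?h ` ?S))"
      by (rule pmp.linear_inj_on_span_independent_image[OF \<phi>, of "?h ` ?S", unfolded \<phi>img, OF ind_g])
    then show "bij_betw \<phi> (pm.span (?h ` ?S)) (pm.span (?g ` ?S))"
      unfolding bij_betw_def using pmp.linear_span_image[OF \<phi>, of "?h ` ?S"] by (simp only: \<phi>img)
    fix b :: "nat set list \<Rightarrow>\<^sub>0 'f" and u assume b: "b \<in> \<B> n" and u: "u \<in> pm.span (?h ` ?S)"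
    obtain c where c: "b = (\<Sum>r\<in>compositions n. pscale (c r) (X_elt r))"
      using \<B>_eq_combination[OF b] .
    have "U_act n b ` pm.span (?h ` ?S) \<subseteq> pm.span (?h ` ?S)"
      unfolding pmp.linear_span_image[OF lin_U_act, symmetric]
    proof (rule pm.span_minimal[OF _ pm.subspace_span], unfold image_image, rule image_subsetI)
      fix xs assume "xs \<in> ?S"
      then show "U_act n b (?h xs) \<in> pm.span (?h ` ?S)"
        unfolding U_act_h[OF c \<open>xs \<in> ?S\<close>]
        by (intro pm.span_sum pm.span_scale pm.span_base imageI T_S)
    qed
    then show "U_act n b u \<in> pm.span (?h ` ?S)" using u by blast
    show "\<phi> (U_act n b u) = wedge b (\<phi> u)"
    proof (rule pmp.linear_eq_on[OF lin_comp[OF \<phi> lin_U_act] lin_comp[OF lin_wedge_right \<phi>] u])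
      fix v assume "v \<in> ?h ` ?S"
      then obtain xs where xs: "xs \<in> ?S" "v = ?h xs" by (rule imageE)
      have "\<phi> (U_act n b v) = (\<Sum>r\<in>compositions n. pscale (c r) (\<Sum>T\<in>?T r. \<phi> (?h (reorder T xs))))"
        unfolding xs(2) U_act_h[OF c xs(1)] lin_sum[OF \<phi>] lin_scale[OF \<phi>] ..
      also have "\<dots> = (\<Sum>r\<in>compositions n. pscale (c r) (\<Sum>T\<in>?T r. ?g (reorder T xs)))"
        by (intro sum.cong refl arg_cong[where f = "pscale _"] \<phi>h T_S xs(1))
      also have "\<dots> = wedge b (\<phi> v)"
        unfolding xs(2) \<phi>h[OF xs(1)] wedge_g[OF c xs(1)] ..
      finally show "\<phi> (U_act n b v) = wedge b (\<phi> v)" .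
    qed
  qed (simp_all add: \<phi>)
qed

end
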